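(* List Coloring Shortest Reconfiguration is fixed-parameter tractable when parameterized by $k+\mathsf{vc}$, where $k$ is an upper bound on the size of the color set and $\mathsf{vc}$ is an upper bound on the size of a minimum vertex cover of the input graph.
   Context: Graphs are finite and simple. Let $C$ be a color set. For a graph $G=(V,E)$ and list $L\colon V\to 2^C$, an $L$-coloring is a map $f\colon V\to C$ with $f(v)\in L(v)$ for all $v$ and $f(v)\neq f(w)$ for every edge $vw$. Two $L$-colorings are adjacent if they differ on exactly one vertex; a reconfiguration sequence of length $\ell$ is a sequence $f_0,\dots,f_\ell$ of $L$-colorings with consecutive ones adjacent. List Coloring Shortest Reconfiguration: given $(G,L,f_0,f_t)$ where there is a reconfiguration sequence from $f_0$ to $f_t$, compute the minimum length of such a sequence. *)

theory Defs
  imports "HOL-Library.FuncSet" "HOL-Library.Log_Nat"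
begin

section \<open>List colorings and their reconfiguration\<close>

definition simple_graph :: "'v set \<Rightarrow> 'v set set \<Rightarrow> bool" where
  "simple_graph V E \<longleftrightarrow> finite V \<and> (\<forall>e\<in>E. e \<subseteq> V \<and> card e = 2)"

text \<open>Colorings are maps from \<open>V\<close> to \<open>C\<close> in the sense of \<^const>\<open>PiE\<close>: they are
  \<^const>\<open>undefined\<close> outside \<open>V\<close>, so that two colorings are equal iff they agree on \<open>V\<close>.\<close>

definition list_coloring ::
  "'v set \<Rightarrow> 'v set set \<Rightarrow> 'c set \<Rightarrow> ('v \<Rightarrow> 'c set) \<Rightarrow> ('v \<Rightarrow> 'c) \<Rightarrow> bool" where
  "list_coloring V E C L f \<longleftrightarrow>
     f \<in> V \<rightarrow>\<^sub>E C \<and> (\<forall>v\<in>V. f v \<in> L v) \<and>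
     (\<forall>v\<in>V. \<forall>w\<in>V. {v, w} \<in> E \<longrightarrow> f v \<noteq> f w)"

definition adjacent_colorings :: "'v set \<Rightarrow> ('v \<Rightarrow> 'c) \<Rightarrow> ('v \<Rightarrow> 'c) \<Rightarrow> bool" where
  "adjacent_colorings V f g \<longleftrightarrow> card {v\<in>V. f v \<noteq> g v} = 1"

definition reconfiguration_sequence ::
  "'v set \<Rightarrow> 'v set set \<Rightarrow> 'c set \<Rightarrow> ('v \<Rightarrow> 'c set) \<Rightarrow> (nat \<Rightarrow> 'v \<Rightarrow> 'c) \<Rightarrow> nat \<Rightarrow> bool" where
  "reconfiguration_sequence V E C L F l \<longleftrightarrow>
     (\<forall>i\<le>l. list_coloring V E C L (F i)) \<and>
     (\<forall>i<l. adjacent_colorings V (F i) (F (Suc i)))"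

definition reconfigurable_in ::
  "'v set \<Rightarrow> 'v set set \<Rightarrow> 'c set \<Rightarrow> ('v \<Rightarrow> 'c set) \<Rightarrow> ('v \<Rightarrow> 'c) \<Rightarrow> ('v \<Rightarrow> 'c) \<Rightarrow> nat \<Rightarrow> bool" where
  "reconfigurable_in V E C L f g l \<longleftrightarrow>
     (\<exists>F. reconfiguration_sequence V E C L F l \<and> F 0 = f \<and> F l = g)"

definition vertex_cover :: "'v set \<Rightarrow> 'v set set \<Rightarrow> 'v set \<Rightarrow> bool" where
  "vertex_cover V E S \<longleftrightarrow> S \<subseteq> V \<and> (\<forall>e\<in>E. e \<inter> S \<noteq> {})"

definition vertex_cover_number :: "'v set \<Rightarrow> 'v set set \<Rightarrow> nat" where
  "vertex_cover_number V E = (LEAST m. \<exists>S. vertex_cover V E S \<and> card S = m)"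


section \<open>Random access machines\<close>

text \<open>
  Programs are structured programs of a random access machine. The memory consists of arrays
  (finitely many are named in any given program), each of which is an unbounded sequence of
  natural numbers, initially \<open>0\<close> beyond the input. The only arithmetic operations are addition
  and truncated subtraction, each at unit cost. There is deliberately no multiplication: numbers
  of at most polynomially many bits arise in polynomially many steps, so the model simulates and
  is simulated by Turing machines with polynomial overhead.
\<close>

type_synonym store = "nat \<Rightarrow> nat \<Rightarrow> nat"

datatype expr =
    Const nat
  | Read nat expr  \<comment> \<open>array name, index\<close>
  | Add expr expr
  | Sub expr expr

primrec eval_expr :: "expr \<Rightarrow> store \<Rightarrow> nat" where
  "eval_expr (Const n) s = n"
| "eval_expr (Read a e) s = s a (eval_expr e s)"
| "eval_expr (Add e1 e2) s = eval_expr e1 s + eval_expr e2 s"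
| "eval_expr (Sub e1 e2) s = eval_expr e1 s - eval_expr e2 s"

primrec expr_cost :: "expr \<Rightarrow> nat" where
  "expr_cost (Const n) = 1"
| "expr_cost (Read a e) = 1 + expr_cost e"
| "expr_cost (Add e1 e2) = 1 + expr_cost e1 + expr_cost e2"
| "expr_cost (Sub e1 e2) = 1 + expr_cost e1 + expr_cost e2"

datatype prog =
    Skip
  | Write nat expr expr  \<comment> \<open>array name, index, new value\<close>
  | Seq prog prog
  | Cond expr prog prog
  | Loop expr prog

text \<open>\<open>exec P s t s'\<close>: started in store \<open>s\<close>, the program \<open>P\<close> halts after exactly \<open>t\<close> steps in
  store \<open>s'\<close>. Guards hold iff they are nonzero.\<close>

inductive exec :: "prog \<Rightarrow> store \<Rightarrow> nat \<Rightarrow> store \<Rightarrow> bool" where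
  Skip: "exec Skip s 1 s"
| Write: "exec (Write a i e) s (1 + expr_cost i + expr_cost e)
            (s(a := (s a)(eval_expr i s := eval_expr e s)))"
| Seq: "exec P s t s' \<Longrightarrow> exec Q s' u s'' \<Longrightarrow> exec (Seq P Q) s (t + u) s''"
| CondTrue: "eval_expr b s \<noteq> 0 \<Longrightarrow> exec P s t s' \<Longrightarrow> exec (Cond b P Q) s (1 + expr_cost b + t) s'"
| CondFalse: "eval_expr b s = 0 \<Longrightarrow> exec Q s t s' \<Longrightarrow> exec (Cond b P Q) s (1 + expr_cost b + t) s'"
| LoopFalse: "eval_expr b s = 0 \<Longrightarrow> exec (Loop b P) s (1 + expr_cost b) s"
| LoopTrue: "eval_expr b s \<noteq> 0 \<Longrightarrow> exec P s t s' \<Longrightarrow> exec (Loop b P) s' u s'' \<Longrightarrow>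
    exec (Loop b P) s (1 + expr_cost b + t + u) s''"

inductive_cases SkipE: "exec Skip s t s'"
inductive_cases WriteE: "exec (Write a i e) s t s'"
inductive_cases SeqE: "exec (Seq P Q) s t s'"
inductive_cases CondE: "exec (Cond b P Q) s t s'"
inductive_cases LoopE: "exec (Loop b P) s t s'"

lemma exec_deterministic:
  assumes "exec P s t s'" and "exec P s u s''"
  shows "t = u \<and> s' = s''"
  using assms
proof (induction arbitrary: u s'' rule: exec.induct)
  case (Skip s)
  then show ?case by (auto elim: SkipE)
next
  case (Write a i e s)
  then show ?case by (auto elim: WriteE)
next
  case (Seq P s t s1 Q t' s2)
  from Seq.prems obtain v s3 v' where "exec P s v s3" "exec Q s3 v' s''" "u = v + v'"
    by (rule SeqE)
  with Seq.IH(1)[of v s3] Seq.IH(2)[of v' s''] show ?case by simp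
next
  case (CondTrue b s P t s1 Q)
  from CondTrue.prems obtain v where "exec P s v s''" "u = 1 + expr_cost b + v"
    by (rule CondE) (use CondTrue.hyps in simp_all)
  with CondTrue.IH[of v s''] show ?case by simp
next
  case (CondFalse b s Q t s1 P)
  from CondFalse.prems obtain v where "exec Q s v s''" "u = 1 + expr_cost b + v"
    by (rule CondE) (use CondFalse.hyps in simp_all)
  with CondFalse.IH[of v s''] show ?case by simp
next
  case (LoopFalse b s P)
  from LoopFalse.prems show ?case by (rule LoopE) (use LoopFalse.hyps in simp_all)
next
  case (LoopTrue b s P t s1 t' s2)
  from LoopTrue.prems obtain v s3 v' where
    "exec P s v s3" "exec (Loop b P) s3 v' s''" "u = 1 + expr_cost b + v + v'"
    by (rule LoopE) (use LoopTrue.hyps in simp_all)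
  with LoopTrue.IH(1)[of v s3] LoopTrue.IH(2)[of v' s''] show ?case by simp
qed

text \<open>The input word is in array 0 and its length in cell 0 of array 1; the result is
  read off from cell 0 of array 2.\<close>

definition initial_store :: "nat list \<Rightarrow> store" where
  "initial_store w = (\<lambda>a i.
     if a = 0 \<and> i < length w then w ! i
     else if a = 1 \<and> i = 0 then length w
     else 0)"

definition outputs_in :: "prog \<Rightarrow> nat list \<Rightarrow> nat \<Rightarrow> nat \<Rightarrow> bool" where
  "outputs_in P w r t \<longleftrightarrow> (\<exists>s. exec P (initial_store w) t s \<and> s 2 0 = r)"

definition computable :: "(nat \<Rightarrow> nat) \<Rightarrow> bool" where
  "computable f \<longleftrightarrow> (\<exists>P. \<forall>d. \<exists>t. outputs_in P [d] (f d) t)"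

text \<open>The length of an input in bits; the additional \<open>1\<close> per number accounts for a separator.\<close>

definition input_size :: "nat list \<Rightarrow> nat" where
  "input_size w = (\<Sum>x\<leftarrow>w. 1 + floorlog 2 x)"


section \<open>Fixed-parameter tractability\<close>

text \<open>A parameterized computational problem consists of a set \<open>X\<close> of instances, which an algorithm
  may rely on as a promise, their encoding as input words, the parameter of each instance, and the
  number to be computed for each instance.\<close>

definition fixed_parameter_tractable ::
  "'x set \<Rightarrow> ('x \<Rightarrow> nat list) \<Rightarrow> ('x \<Rightarrow> nat) \<Rightarrow> ('x \<Rightarrow> nat) \<Rightarrow> bool" where
  "fixed_parameter_tractable X encode param solution \<longleftrightarrow>
     (\<exists>P f c. computable f \<and>
        (\<forall>x\<in>X. \<exists>t. outputs_in P (encode x) (solution x) t \<and>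
                   t \<le> f (param x) * input_size (encode x) ^ c))"


section \<open>List Coloring Shortest Reconfiguration\<close>

text \<open>As inputs to an algorithm, the vertices and the colors are numbered from \<open>0\<close>. The last two
  fields are the upper bounds that make up the parameter.\<close>

record lcsr_input =
  num_vertices :: nat
  num_colors :: nat
  edge_set :: "nat set set"
  color_lists :: "nat \<Rightarrow> nat set"
  start_coloring :: "nat \<Rightarrow> nat"
  target_coloring :: "nat \<Rightarrow> nat"
  color_bound :: nat
  cover_bound :: nat

definition vertex_set :: "lcsr_input \<Rightarrow> nat set" where
  "vertex_set I = {..<num_vertices I}"

definition color_set :: "lcsr_input \<Rightarrow> nat set" where
  "color_set I = {..<num_colors I}"

definition lcsr_reconfigurable_in :: "lcsr_input \<Rightarrow> nat \<Rightarrow> bool" where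
  "lcsr_reconfigurable_in I l \<longleftrightarrow>
     reconfigurable_in (vertex_set I) (edge_set I) (color_set I) (color_lists I)
       (start_coloring I) (target_coloring I) l"

definition list_coloring_shortest_reconfiguration :: "lcsr_input set" where
  "list_coloring_shortest_reconfiguration =
     {I. simple_graph (vertex_set I) (edge_set I) \<and>
         (\<forall>v\<in>vertex_set I. color_lists I v \<subseteq> color_set I) \<and>
         list_coloring (vertex_set I) (edge_set I) (color_set I) (color_lists I)
           (start_coloring I) \<and>
         list_coloring (vertex_set I) (edge_set I) (color_set I) (color_lists I)
           (target_coloring I) \<and>
         (\<exists>l. lcsr_reconfigurable_in I l) \<and>
         card (color_set I) \<le> color_bound I \<and>
         vertex_cover_number (vertex_set I) (edge_set I) \<le> cover_bound I}"

definition shortest_reconfiguration_length :: "lcsr_input \<Rightarrow> nat" where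
  "shortest_reconfiguration_length I = (LEAST l. lcsr_reconfigurable_in I l)"

text \<open>Four numbers, followed by the adjacency matrix of the graph, the 0-1 matrix of the lists (one
  row per vertex) and the values of the two colorings.\<close>

definition encode_lcsr :: "lcsr_input \<Rightarrow> nat list" where
  "encode_lcsr I =
     (let vs = [0..<num_vertices I]; cs = [0..<num_colors I] in
       [num_vertices I, num_colors I, color_bound I, cover_bound I] @
       concat (map (\<lambda>v. map (\<lambda>w. if {v, w} \<in> edge_set I then 1 else 0) vs) vs) @
       concat (map (\<lambda>v. map (\<lambda>c. if c \<in> color_lists I v then 1 else 0) cs) vs) @
       map (start_coloring I) vs @
       map (target_coloring I) vs)"

end

theory Submission
  imports Defs
begin

text \<open>
  Two vertices are twins if they have the same neighborhood, the same list and the same initial and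
  final color. Twins are not adjacent, so in a shortest sequence all members of a class of twins may
  copy the one that is recolored least often. It therefore suffices to consider colorings that are
  constant on the classes, where recoloring a class costs its size. Apart from at most \<open>vc\<close> vertices
  of a vertex cover, the class of a vertex is determined by a subset of the cover, a list and two
  colors, so that the number of classes and hence the number \<open>N\<close> of such colorings is bounded in
  terms of the parameter. A cheapest walk visits each of them at most once and so has weight at most
  \<open>n * N\<close>; a table of the pairs of a weight and a coloring that are realized by a walk is filled in by
  increasing weight. Finding the classes does not need a vertex cover.
\<close>

text \<open>The statement speaks of a concrete machine, so the combinatorics has to become loops
  whose numbers of iterations are known. A language of total loop expressions is compiled once, with
  correctness and time proved together and a single number \<open>B\<close> bounding every loop; the
  algorithm then reduces to equations about \<open>heval\<close>. Its time is polynomial in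
  \<open>B\<close> with a degree fixed by the program, so it suffices that \<open>B\<close> is the
  input size times a computable function of the parameter. Requiring equal initial and final colors
  of twins makes both given colorings constant on classes. A step that recolors a whole class can be
  carried out vertex by vertex, because the class is independent. Class-uniform colorings are
  represented by numbers whose base-\<open>num_colors I\<close> digits are the colors of the
  classes, so that ranging over colorings is counting.\<close>

section \<open>Total correctness with running times\<close>

text \<open>An upper bound on the running time of a program all of whose loops, whenever they are
  entered, make at most \<open>B\<close> iterations.\<close>

primrec time_bound :: "nat \<Rightarrow> prog \<Rightarrow> nat" where
  "time_bound B Skip = 1"
| "time_bound B (Write a i e) = 1 + expr_cost i + expr_cost e"
| "time_bound B (Seq P Q) = time_bound B P + time_bound B Q"
| "time_bound B (Cond b P Q) = 1 + expr_cost b + time_bound B P + time_bound B Q"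
| "time_bound B (Loop b P) = (B + 1) * (1 + expr_cost b + time_bound B P)"

text \<open>Both \<open>c\<close> and \<open>h\<close> depend on the program alone, which is what
  allows \<open>h\<close> to become the constant exponent of the input size. Adding exponents
  instead of taking their maximum is crude but sufficient.\<close>

lemma time_bound_polynomial: "\<exists>c h. \<forall>B. time_bound B P \<le> c * (B + 1) ^ h"
proof (induction P)
  case Skip
  show ?case by (rule exI[of _ 1], rule exI[of _ 0]) simp
next
  case (Write a i e)
  show ?case by (rule exI[of _ "1 + expr_cost i + expr_cost e"], rule exI[of _ 0]) simp
next
  case (Seq P Q)
  then obtain c1 h1 c2 h2 where
    1: "\<And>B. time_bound B P \<le> c1 * (B + 1) ^ h1" and 2: "\<And>B. time_bound B Q \<le> c2 * (B + 1) ^ h2"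
    by blast
  have "time_bound B (Seq P Q) \<le> (c1 + c2) * (B + 1) ^ (h1 + h2)" for B
  proof -
    have "c1 * (B + 1) ^ h1 \<le> c1 * (B + 1) ^ (h1 + h2)" "c2 * (B + 1) ^ h2 \<le> c2 * (B + 1) ^ (h1 + h2)"
      by (intro mult_left_mono power_increasing; simp)+
    then show ?thesis using 1[of B] 2[of B] unfolding time_bound.simps ring_distribs by linarith
  qed
  then show ?case by blast
next
  case (Cond b P Q)
  then obtain c1 h1 c2 h2 where
    1: "\<And>B. time_bound B P \<le> c1 * (B + 1) ^ h1" and 2: "\<And>B. time_bound B Q \<le> c2 * (B + 1) ^ h2"
    by blast
  have "time_bound B (Cond b P Q) \<le> (1 + expr_cost b + c1 + c2) * (B + 1) ^ (h1 + h2)" for B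
  proof -
    have "c1 * (B + 1) ^ h1 \<le> c1 * (B + 1) ^ (h1 + h2)" "c2 * (B + 1) ^ h2 \<le> c2 * (B + 1) ^ (h1 + h2)"
      "(1 + expr_cost b) * 1 \<le> (1 + expr_cost b) * (B + 1) ^ (h1 + h2)"
      by (intro mult_left_mono power_increasing one_le_power; simp)+
    then show ?thesis using 1[of B] 2[of B] unfolding time_bound.simps ring_distribs by linarith
  qed
  then show ?case by blast
next
  case (Loop b P)
  then obtain c h where 1: "\<And>B. time_bound B P \<le> c * (B + 1) ^ h" by blast
  have "time_bound B (Loop b P) \<le> (1 + expr_cost b + c) * (B + 1) ^ (h + 1)" for B
  proof -
    have "(1 + expr_cost b) * 1 \<le> (1 + expr_cost b) * (B + 1) ^ h"
      by (intro mult_left_mono one_le_power) simp_all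
    then have "1 + expr_cost b + time_bound B P \<le> (1 + expr_cost b + c) * (B + 1) ^ h"
      using 1[of B] unfolding ring_distribs by linarith
    then have "(B + 1) * (1 + expr_cost b + time_bound B P)
        \<le> (B + 1) * ((1 + expr_cost b + c) * (B + 1) ^ h)" by (rule mult_left_mono) simp
    then show ?thesis unfolding time_bound.simps power_add power_one_right by (simp only: mult_ac)
  qed
  then show ?case by blast
qed

text \<open>Total correctness for one start store, in the style of weakest preconditions: sequencing
  nests \<open>runs\<close> in the postcondition, and the time bound is carried along
  silently.\<close>

definition runs :: "nat \<Rightarrow> prog \<Rightarrow> store \<Rightarrow> (store \<Rightarrow> bool) \<Rightarrow> bool" where
  "runs B P s Q \<longleftrightarrow> (\<exists>t s'. exec P s t s' \<and> t \<le> time_bound B P \<and> Q s')"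

lemma runs_mono: "runs B P s Q \<Longrightarrow> (\<And>s'. Q s' \<Longrightarrow> R s') \<Longrightarrow> runs B P s R"
  unfolding runs_def by blast

lemma runs_Write:
  "Q (s(a := (s a)(eval_expr i s := eval_expr e s))) \<Longrightarrow> runs B (Write a i e) s Q"
  unfolding runs_def time_bound.simps by (blast intro: exec.Write)

lemma runs_Seq: "runs B P s (\<lambda>s'. runs B Q s' R) \<Longrightarrow> runs B (Seq P Q) s R"
  unfolding runs_def time_bound.simps by (blast intro: exec.Seq add_mono)

text \<open>The invariant is indexed by the number of completed iterations. As the count
  \<open>c\<close> is known in advance, the index also serves as termination measure.\<close>

lemma runs_Loop:
  assumes "I 0 s" and "c \<le> B"
    and body: "\<And>i s. i < c \<Longrightarrow> I i s \<Longrightarrow> eval_expr b s \<noteq> 0 \<and> runs B P s (I (Suc i))"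
    and stop: "\<And>s. I c s \<Longrightarrow> eval_expr b s = 0"
  shows "runs B (Loop b P) s (I c)"
proof -
  let ?t = "1 + expr_cost b + time_bound B P"
  \<comment> \<open>Here \<open>j\<close> iterations remain; the extra \<open>1\<close> in
    \<open>j + 1\<close> pays for the last, failing guard test.\<close>
  have "\<exists>t s'. exec (Loop b P) s t s' \<and> t \<le> (j + 1) * ?t \<and> I c s'" if "I i s" "i + j = c" for i j s
    using that
  proof (induction j arbitrary: i s)
    case 0
    then have "I c s" by simp
    moreover from this have "exec (Loop b P) s (1 + expr_cost b) s" by (intro exec.LoopFalse stop)
    ultimately show ?case by (intro exI[of _ "1 + expr_cost b"] exI[of _ s]) simp
  next
    case (Suc j)
    then have "i < c" by simp
    with body[OF this Suc.prems(1)] obtain t s' where 1: "eval_expr b s \<noteq> 0" "exec P s t s'"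
      "t \<le> time_bound B P" "I (Suc i) s'" unfolding runs_def by blast
    with Suc.IH[of "Suc i" s'] Suc.prems obtain u s'' where
      2: "exec (Loop b P) s' u s''" "u \<le> (j + 1) * ?t" "I c s''" by auto
    have "1 + expr_cost b + t + u \<le> (Suc j + 1) * ?t" using 1 2 by simp
    with exec.LoopTrue[OF 1(1,2) 2(1)] 2(3) show ?case by blast
  qed
  from this[of 0 s c] assms(1) obtain t s' where
    "exec (Loop b P) s t s'" "t \<le> (c + 1) * ?t" "I c s'" by auto
  moreover have "(c + 1) * ?t \<le> (B + 1) * ?t" using assms(2) by (intro mult_right_mono) simp_all
  ultimately show ?thesis unfolding runs_def by (auto intro!: exI[of _ t] exI[of _ s'])
qed


section \<open>A language of loop expressions and its compiler\<close>

text \<open>\<open>BSum\<close> and \<open>Iter\<close> bind one de Bruijn variable in their last argument: the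
  summation index, respectively the value iterated so far. \<open>Inp\<close> reads the input word, \<open>Tab\<close> a
  table of previously computed values.\<close>

datatype hexp =
    Num nat
  | Var nat
  | Inp hexp
  | Tab hexp
  | Plus hexp hexp
  | Minus hexp hexp
  | Times hexp hexp
  | Quot hexp hexp
  | BSum hexp hexp
  | Iter hexp hexp hexp

primrec heval :: "(nat \<Rightarrow> nat) \<Rightarrow> (nat \<Rightarrow> nat) \<Rightarrow> hexp \<Rightarrow> nat list \<Rightarrow> nat" where
  "heval inp tab (Num c) \<rho> = c"
| "heval inp tab (Var x) \<rho> = \<rho> ! x"
| "heval inp tab (Inp h) \<rho> = inp (heval inp tab h \<rho>)"
| "heval inp tab (Tab h) \<rho> = tab (heval inp tab h \<rho>)"
| "heval inp tab (Plus g h) \<rho> = heval inp tab g \<rho> + heval inp tab h \<rho>"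
| "heval inp tab (Minus g h) \<rho> = heval inp tab g \<rho> - heval inp tab h \<rho>"
| "heval inp tab (Times g h) \<rho> = heval inp tab g \<rho> * heval inp tab h \<rho>"
| "heval inp tab (Quot g h) \<rho> = heval inp tab g \<rho> div heval inp tab h \<rho>"
| "heval inp tab (BSum e h) \<rho> = (\<Sum>i<heval inp tab e \<rho>. heval inp tab h (i # \<rho>))"
| "heval inp tab (Iter e a h) \<rho> =
     ((\<lambda>x. heval inp tab h (x # \<rho>)) ^^ heval inp tab e \<rho>) (heval inp tab a \<rho>)"

text \<open>Evaluation is well defined and each of its loops makes at most \<open>B\<close> iterations.\<close>

primrec bounded_by :: "nat \<Rightarrow> (nat \<Rightarrow> nat) \<Rightarrow> (nat \<Rightarrow> nat) \<Rightarrow> hexp \<Rightarrow> nat list \<Rightarrow> bool" where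
  "bounded_by B inp tab (Num c) \<rho> \<longleftrightarrow> True"
| "bounded_by B inp tab (Var x) \<rho> \<longleftrightarrow> x < length \<rho>"
| "bounded_by B inp tab (Inp h) \<rho> \<longleftrightarrow> bounded_by B inp tab h \<rho>"
| "bounded_by B inp tab (Tab h) \<rho> \<longleftrightarrow> bounded_by B inp tab h \<rho>"
| "bounded_by B inp tab (Plus g h) \<rho> \<longleftrightarrow> bounded_by B inp tab g \<rho> \<and> bounded_by B inp tab h \<rho>"
| "bounded_by B inp tab (Minus g h) \<rho> \<longleftrightarrow> bounded_by B inp tab g \<rho> \<and> bounded_by B inp tab h \<rho>"
| "bounded_by B inp tab (Times g h) \<rho> \<longleftrightarrow> bounded_by B inp tab g \<rho> \<and> bounded_by B inp tab h \<rho> \<and>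
     heval inp tab g \<rho> \<le> B"
| "bounded_by B inp tab (Quot g h) \<rho> \<longleftrightarrow> bounded_by B inp tab g \<rho> \<and> bounded_by B inp tab h \<rho> \<and>
     0 < heval inp tab h \<rho> \<and> heval inp tab g \<rho> div heval inp tab h \<rho> \<le> B"
| "bounded_by B inp tab (BSum e h) \<rho> \<longleftrightarrow> bounded_by B inp tab e \<rho> \<and> heval inp tab e \<rho> \<le> B \<and>
     (\<forall>i<heval inp tab e \<rho>. bounded_by B inp tab h (i # \<rho>))"
| "bounded_by B inp tab (Iter e a h) \<rho> \<longleftrightarrow> bounded_by B inp tab e \<rho> \<and> bounded_by B inp tab a \<rho> \<and>
     heval inp tab e \<rho> \<le> B \<and> (\<forall>i<heval inp tab e \<rho>.
       bounded_by B inp tab h (((\<lambda>x. heval inp tab h (x # \<rho>)) ^^ i) (heval inp tab a \<rho>) # \<rho>))"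

text \<open>Array 3 holds the values of the variables, the outermost binder at index \<open>0\<close>, and array 4 is a
  stack of temporary values. The code for an expression below \<open>b\<close> binders leaves its value in cell
  \<open>d\<close> of the stack and does not touch the cells further down.\<close>

abbreviation temp :: "nat \<Rightarrow> expr" where "temp d \<equiv> Read 4 (Const d)"
abbreviation set_temp :: "nat \<Rightarrow> expr \<Rightarrow> prog" where "set_temp d \<equiv> Write 4 (Const d)"
abbreviation var :: "nat \<Rightarrow> expr" where "var x \<equiv> Read 3 (Const x)"
abbreviation set_var :: "nat \<Rightarrow> expr \<Rightarrow> prog" where "set_var x \<equiv> Write 3 (Const x)"

primrec compile :: "hexp \<Rightarrow> nat \<Rightarrow> nat \<Rightarrow> prog" where
  "compile (Num c) b d = set_temp d (Const c)"
| "compile (Var x) b d = set_temp d (var (b - 1 - x))"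
| "compile (Inp h) b d = Seq (compile h b d) (set_temp d (Read 0 (temp d)))"
| "compile (Tab h) b d = Seq (compile h b d) (set_temp d (Read 5 (temp d)))"
| "compile (Plus g h) b d = Seq (compile g b d) (Seq (compile h b (Suc d))
     (set_temp d (Add (temp d) (temp (Suc d)))))"
| "compile (Minus g h) b d = Seq (compile g b d) (Seq (compile h b (Suc d))
     (set_temp d (Sub (temp d) (temp (Suc d)))))"
| "compile (Times g h) b d = Seq (compile g b d) (Seq (compile h b (Suc d))
     (Seq (set_temp (Suc (Suc d)) (Const 0))
     (Seq (Loop (temp d)
            (Seq (set_temp (Suc (Suc d)) (Add (temp (Suc (Suc d))) (temp (Suc d))))
                 (set_temp d (Sub (temp d) (Const 1)))))
          (set_temp d (temp (Suc (Suc d)))))))"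
| "compile (Quot g h) b d = Seq (compile g b d) (Seq (compile h b (Suc d))
     (Seq (set_temp (Suc (Suc d)) (Const 0))
     (Seq (Loop (Sub (Add (temp d) (Const 1)) (temp (Suc d)))
            (Seq (set_temp (Suc (Suc d)) (Add (temp (Suc (Suc d))) (Const 1)))
                 (set_temp d (Sub (temp d) (temp (Suc d))))))
          (set_temp d (temp (Suc (Suc d)))))))"
| "compile (BSum e h) b d = Seq (compile e b d)
     (Seq (set_temp (Suc d) (Const 0))
     (Seq (set_var b (Const 0))
     (Seq (Loop (Sub (temp d) (var b))
            (Seq (compile h (Suc b) (Suc (Suc d)))
            (Seq (set_temp (Suc d) (Add (temp (Suc d)) (temp (Suc (Suc d)))))
                 (set_var b (Add (var b) (Const 1))))))
          (set_temp d (temp (Suc d))))))"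
| "compile (Iter e a h) b d = Seq (compile e b d) (Seq (compile a b (Suc d))
     (Seq (set_var b (temp (Suc d)))
     (Seq (Loop (temp d)
            (Seq (compile h (Suc b) (Suc d))
            (Seq (set_var b (temp (Suc d)))
                 (set_temp d (Sub (temp d) (Const 1))))))
          (set_temp d (var b)))))"

text \<open>The list has the innermost variable first, while array 3 is addressed by binding level,
  so that entering a binder writes one cell and moves none.\<close>

primrec env :: "nat list \<Rightarrow> store \<Rightarrow> bool" where
  "env [] s \<longleftrightarrow> True"
| "env (x # \<rho>) s \<longleftrightarrow> s 3 (length \<rho>) = x \<and> env \<rho> s"

lemma env_nth: "env \<rho> s \<Longrightarrow> x < length \<rho> \<Longrightarrow> s 3 (length \<rho> - Suc x) = \<rho> ! x"
proof (induction \<rho> arbitrary: x)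
  case (Cons y \<rho>)
  then show ?case by (cases x) auto
qed simp

lemma env_cong: "(\<And>j. j < length \<rho> \<Longrightarrow> s' 3 j = s 3 j) \<Longrightarrow> env \<rho> s' = env \<rho> s"
  by (induction \<rho>) auto

text \<open>Result and frame in one. Cells from \<open>b\<close> on in array 3 and above
  \<open>d\<close> in array 4 are scratch space; the input and the table survive, so
  \<open>heval (s 0) (s 5)\<close> means the same afterwards.\<close>

definition leaves :: "nat \<Rightarrow> nat \<Rightarrow> nat \<Rightarrow> store \<Rightarrow> store \<Rightarrow> bool" where
  "leaves b d v s s' \<longleftrightarrow> s' 4 d = v \<and> (\<forall>j<d. s' 4 j = s 4 j) \<and> (\<forall>j<b. s' 3 j = s 3 j) \<and>
     (\<forall>a. a \<noteq> 3 \<longrightarrow> a \<noteq> 4 \<longrightarrow> s' a = s a)"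

text \<open>The store is generalized because a second operand runs in the store left by the first;
  the frame in \<open>leaves\<close> keeps its meaning. Time needs no separate argument: the loop
  rule only asks that the count is at most \<open>B\<close>, which \<open>bounded_by\<close>
  provides.\<close>

lemma compile_correct:
  assumes "env \<rho> s" and "bounded_by B (s 0) (s 5) h \<rho>"
  shows "runs B (compile h (length \<rho>) d) s (leaves (length \<rho>) d (heval (s 0) (s 5) h \<rho>) s)"
  using assms
proof (induction h arbitrary: \<rho> s d)
  case (Num c)
  show ?case by (auto intro!: runs_Write simp: leaves_def)
next
  case (Var x)
  then show ?case by (auto intro!: runs_Write simp: leaves_def env_nth)
next
  case (Inp h)
  then have "runs B (compile h (length \<rho>) d) s (leaves (length \<rho>) d (heval (s 0) (s 5) h \<rho>) s)"
    by simp
  then show ?case by (auto intro!: runs_Seq runs_Write elim!: runs_mono simp: leaves_def)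
next
  case (Tab h)
  then have "runs B (compile h (length \<rho>) d) s (leaves (length \<rho>) d (heval (s 0) (s 5) h \<rho>) s)"
    by simp
  then show ?case by (auto intro!: runs_Seq runs_Write elim!: runs_mono simp: leaves_def)
next
  case (Plus g h)
  show ?case
    unfolding compile.simps
  proof (rule runs_Seq, rule runs_mono, rule Plus.IH(1), goal_cases)
    case (3 s1)
    then have e: "env \<rho> s1" and [simp]: "s1 0 = s 0" "s1 5 = s 5"
      using Plus.prems by (auto simp: leaves_def cong: env_cong)
    show ?case
    proof (rule runs_Seq, rule runs_mono, rule Plus.IH(2)[OF e], goal_cases)
      case (2 s2)
      with 3 show ?case by (auto intro!: runs_Write simp: leaves_def)
    qed (use Plus.prems in simp)
  qed (use Plus.prems in simp_all)
next
  case (Minus g h)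
  show ?case
    unfolding compile.simps
  proof (rule runs_Seq, rule runs_mono, rule Minus.IH(1), goal_cases)
    case (3 s1)
    then have e: "env \<rho> s1" and [simp]: "s1 0 = s 0" "s1 5 = s 5"
      using Minus.prems by (auto simp: leaves_def cong: env_cong)
    show ?case
    proof (rule runs_Seq, rule runs_mono, rule Minus.IH(2)[OF e], goal_cases)
      case (2 s2)
      with 3 show ?case by (auto intro!: runs_Write simp: leaves_def)
    qed (use Minus.prems in simp)
  qed (use Minus.prems in simp_all)
next
  case (Times g h)
  let ?v = "heval (s 0) (s 5) g \<rho>" and ?w = "heval (s 0) (s 5) h \<rho>" and ?b = "length \<rho>"
  show ?case
    unfolding compile.simps
  proof (rule runs_Seq, rule runs_mono, rule Times.IH(1), goal_cases)
    case (3 s1)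
    then have e: "env \<rho> s1" and [simp]: "s1 0 = s 0" "s1 5 = s 5"
      using Times.prems by (auto simp: leaves_def cong: env_cong)
    show ?case
    proof (rule runs_Seq, rule runs_mono, rule Times.IH(2)[OF e], goal_cases)
      case (2 s2)
      let ?I = "\<lambda>i s'. leaves ?b d (?v - i) s s' \<and> s' 4 (Suc d) = ?w \<and> s' 4 (Suc (Suc d)) = i * ?w"
      show ?case
        by (intro runs_Seq runs_Write,
            rule runs_mono[OF runs_Loop[where I = ?I and c = ?v]])
          (use 2 3 Times.prems in \<open>auto intro!: runs_Write runs_Seq simp: leaves_def\<close>)
    qed (use Times.prems in simp)
  qed (use Times.prems in simp_all)
next
  case (Quot g h)
  let ?v = "heval (s 0) (s 5) g \<rho>" and ?w = "heval (s 0) (s 5) h \<rho>" and ?b = "length \<rho>"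
  have w: "0 < ?w" using Quot.prems by simp
  \<comment> \<open>With truncated subtraction the guard is nonzero iff the remainder is at least
    the divisor. \<open>more\<close> keeps it true for \<open>?v div ?w\<close> rounds and
    \<open>less\<close> makes it fail then; a zero divisor would loop forever.\<close>
  have more: "i * ?w + ?w \<le> ?v" if "i < ?v div ?w" for i
  proof -
    have "(i + 1) * ?w \<le> (?v div ?w) * ?w" using that by (intro mult_right_mono) simp_all
    also have "\<dots> \<le> ?v" by simp
    finally show ?thesis by simp
  qed
  have less: "?v - (?v div ?w) * ?w < ?w"
    using w by (simp add: minus_div_mult_eq_mod)
  show ?case
    unfolding compile.simps
  proof (rule runs_Seq, rule runs_mono, rule Quot.IH(1), goal_cases)
    case (3 s1)
    then have e: "env \<rho> s1" and [simp]: "s1 0 = s 0" "s1 5 = s 5"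
      using Quot.prems by (auto simp: leaves_def cong: env_cong)
    show ?case
    proof (rule runs_Seq, rule runs_mono, rule Quot.IH(2)[OF e], goal_cases)
      case (2 s2)
      let ?I = "\<lambda>i s'. leaves ?b d (?v - i * ?w) s s' \<and> s' 4 (Suc d) = ?w \<and> s' 4 (Suc (Suc d)) = i"
      show ?case
        by (intro runs_Seq runs_Write,
            rule runs_mono[OF runs_Loop[where I = ?I and c = "?v div ?w"]])
          (use 2 3 Quot.prems less in \<open>auto intro!: runs_Write runs_Seq dest!: more simp: leaves_def\<close>)
    qed (use Quot.prems in simp)
  qed (use Quot.prems in simp_all)
next
  case (BSum e h)
  let ?c = "heval (s 0) (s 5) e \<rho>" and ?b = "length \<rho>"
  let ?g = "\<lambda>i. heval (s 0) (s 5) h (i # \<rho>)"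
  define I where "I i s' \<longleftrightarrow> leaves ?b d ?c s s' \<and> s' 4 (Suc d) = (\<Sum>i<i. ?g i) \<and> s' 3 ?b = i" for i s'
  show ?case
    unfolding compile.simps
  proof (rule runs_Seq, rule runs_mono, rule BSum.IH(1), goal_cases)
    case (3 s1)
    have body: "runs B (Seq (compile h (Suc ?b) (Suc (Suc d)))
            (Seq (set_temp (Suc d) (Add (temp (Suc d)) (temp (Suc (Suc d)))))
                 (set_var ?b (Add (var ?b) (Const 1))))) s' (I (Suc i))"
      if "i < ?c" "I i s'" for i s'
    proof -
      have e: "env (i # \<rho>) s'" and [simp]: "s' 0 = s 0" "s' 5 = s 5"
        using BSum.prems that by (auto simp: I_def leaves_def cong: env_cong)
      have "runs B (compile h (Suc ?b) (Suc (Suc d))) s'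
          (leaves (Suc ?b) (Suc (Suc d)) (?g i) s')"
        using BSum.IH(2)[OF e, of "Suc (Suc d)"] that(1) BSum.prems by simp
      then show ?thesis using that
        by (intro runs_Seq runs_Write, elim runs_mono) (auto intro!: runs_Seq runs_Write simp: I_def leaves_def)
    qed
    show ?case
    proof (intro runs_Seq runs_Write, rule runs_mono[OF runs_Loop[where I = I and c = ?c]], goal_cases)
      case (3 i s')
      then have "eval_expr (Sub (temp d) (var ?b)) s' \<noteq> 0" by (simp add: I_def leaves_def)
      with body[OF 3] show ?case by blast
    qed (use 3 BSum.prems in \<open>auto intro!: runs_Write simp: I_def leaves_def\<close>)
  qed (use BSum.prems in simp_all)
next
  case (Iter e a h)
  let ?c = "heval (s 0) (s 5) e \<rho>" and ?b = "length \<rho>"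
  let ?g = "\<lambda>i. ((\<lambda>x. heval (s 0) (s 5) h (x # \<rho>)) ^^ i) (heval (s 0) (s 5) a \<rho>)"
  define I where "I i s' \<longleftrightarrow> leaves ?b d (?c - i) s s' \<and> s' 3 ?b = ?g i" for i s'
  show ?case
    unfolding compile.simps
  proof (rule runs_Seq, rule runs_mono, rule Iter.IH(1), goal_cases)
    case (3 s1)
    then have e: "env \<rho> s1" and [simp]: "s1 0 = s 0" "s1 5 = s 5"
      using Iter.prems by (auto simp: leaves_def cong: env_cong)
    have body: "runs B (Seq (compile h (Suc ?b) (Suc d))
            (Seq (set_var ?b (temp (Suc d)))
                 (set_temp d (Sub (temp d) (Const 1))))) s' (I (Suc i))"
      if "i < ?c" "I i s'" for i s'
    proof -
      have e: "env (?g i # \<rho>) s'" and [simp]: "s' 0 = s 0" "s' 5 = s 5"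
        using Iter.prems that by (auto simp: I_def leaves_def cong: env_cong)
      have "runs B (compile h (Suc ?b) (Suc d)) s' (leaves (Suc ?b) (Suc d) (?g (Suc i)) s')"
        using Iter.IH(3)[OF e, of "Suc d"] that(1) Iter.prems by simp
      then show ?thesis using that
        by (intro runs_Seq runs_Write, elim runs_mono) (auto intro!: runs_Seq runs_Write simp: I_def leaves_def)
    qed
    show ?case
    proof (rule runs_Seq, rule runs_mono, rule Iter.IH(2)[OF e], goal_cases)
      case (2 s2)
      show ?case
      proof (intro runs_Seq runs_Write, rule runs_mono[OF runs_Loop[where I = I and c = ?c]], goal_cases)
        case (3 i s')
        then have "eval_expr (temp d) s' \<noteq> 0" by (simp add: I_def leaves_def)
        with body[OF 3] show ?case by blast
      qed (use 2 3 Iter.prems in \<open>auto intro!: runs_Write simp: I_def leaves_def\<close>)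
    qed (use Iter.prems in simp)
  qed (use Iter.prems in simp_all)
qed


section \<open>Recoloring independent sets\<close>

lemma reconfigurable_in_refl:
  "list_coloring V E C L f \<Longrightarrow> reconfigurable_in V E C L f f 0"
  unfolding reconfigurable_in_def reconfiguration_sequence_def by auto

lemma reconfigurable_in_Suc:
  assumes "reconfigurable_in V E C L f g l" and "adjacent_colorings V g h" and "list_coloring V E C L h"
  shows "reconfigurable_in V E C L f h (Suc l)"
proof -
  obtain F where F: "reconfiguration_sequence V E C L F l" "F 0 = f" "F l = g"
    using assms(1) unfolding reconfigurable_in_def by blast
  have "reconfiguration_sequence V E C L (F(Suc l := h)) (Suc l)"
    using F assms(2,3) unfolding reconfiguration_sequence_def by (auto simp: le_Suc_eq less_Suc_eq)
  with F show ?thesis unfolding reconfigurable_in_def by (intro exI[of _ "F(Suc l := h)"]) simp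
qed

text \<open>On every edge \<open>g\<close> and \<open>h\<close> agree at one end, so one vertex can
  be switched from \<open>g\<close> to \<open>h\<close> on its own: an edge at the switched vertex
  is proper because of \<open>h\<close>, any other because of \<open>g\<close>. Induction on the
  number of disagreements gives one step for each.\<close>

lemma reconfigurable_in_recolor_independent:
  assumes "finite V" and "reconfigurable_in V E C L f g l"
    and "list_coloring V E C L g" and "list_coloring V E C L h"
    and "\<And>u v. u \<in> V \<Longrightarrow> v \<in> V \<Longrightarrow> g u \<noteq> h u \<Longrightarrow> g v \<noteq> h v \<Longrightarrow> {u, v} \<notin> E"
  shows "reconfigurable_in V E C L f h (l + card {v\<in>V. g v \<noteq> h v})"
  using assms
proof (induction "card {v\<in>V. g v \<noteq> h v}" arbitrary: g l)
  case 0
  then have "\<forall>v\<in>V. g v = h v" by auto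
  moreover have "g \<in> V \<rightarrow>\<^sub>E C" "h \<in> V \<rightarrow>\<^sub>E C" using 0 by (auto simp: list_coloring_def)
  ultimately have "g = h" by (blast intro: PiE_ext)
  with 0 show ?case by simp
next
  case (Suc c)
  let ?D = "\<lambda>g. {v\<in>V. g v \<noteq> h v}"
  from Suc.hyps(2) have "?D g \<noteq> {}" by (metis card.empty nat.distinct(1))
  then obtain v where v: "v \<in> V" "g v \<noteq> h v" by blast
  let ?g = "g(v := h v)"
  have D: "?D ?g = ?D g - {v}" by auto
  have fin: "finite (?D g)" using Suc.prems(1) by simp
  have c: "c = card (?D ?g)" unfolding D using Suc.hyps(2) v fin by simp
  have g: "list_coloring V E C L ?g"
  proof -
    have "?g \<in> V \<rightarrow>\<^sub>E C"
    proof -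
      have "h v \<in> C" "g \<in> V \<rightarrow>\<^sub>E C"
        using Suc.prems(3,4) v PiE_mem by (fastforce simp: list_coloring_def)+
      then show ?thesis using PiE_fun_upd[of "h v" "\<lambda>_. C" v g V] v by (simp add: insert_absorb)
    qed
    moreover have "?g a \<noteq> ?g b" if ab: "a \<in> V" "b \<in> V" "{a, b} \<in> E" for a b
    proof -
      have "g a \<noteq> g b" "h a \<noteq> h b" using Suc.prems(3,4) ab by (simp_all add: list_coloring_def)
      moreover have "g a = h a \<or> g b = h b" using Suc.prems(5)[OF ab(1,2)] ab(3) by blast
      ultimately show ?thesis using v(2) by (cases "a = v"; cases "b = v") auto
    qed
    ultimately show ?thesis using Suc.prems(3,4) v by (simp add: list_coloring_def)
  qed
  have "reconfigurable_in V E C L f ?g (Suc l)"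
  proof (rule reconfigurable_in_Suc[OF Suc.prems(2) _ g])
    have "{w\<in>V. g w \<noteq> ?g w} = {v}" using v by auto
    then show "adjacent_colorings V g ?g" by (simp add: adjacent_colorings_def)
  qed
  then have "reconfigurable_in V E C L f h (Suc l + card (?D ?g))"
  proof (rule Suc.hyps(1)[OF c Suc.prems(1) _ g Suc.prems(4)])
    fix a b assume ab: "a \<in> V" "b \<in> V" "?g a \<noteq> h a" "?g b \<noteq> h b"
    then have "g a \<noteq> h a" "g b \<noteq> h b" by (auto split: if_splits)
    then show "{a, b} \<notin> E" using Suc.prems(5) ab(1,2) by blast
  qed
  then show ?case unfolding Suc.hyps(2)[symmetric] c[symmetric] by simp
qed


section \<open>Class-uniform colorings\<close>

text \<open>Base-\<open>k\<close> expansion, least significant digit first. For \<open>m = 0\<close>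
  it yields \<open>0\<close> even if \<open>k = 0\<close>, which covers an instance without vertices
  and colors.\<close>

lemma exists_digits:
  fixes k :: nat
  assumes "\<And>j. j < m \<Longrightarrow> g j < k"
  shows "\<exists>x < k ^ m. \<forall>j<m. x div k ^ j mod k = g j"
  using assms
proof (induction m arbitrary: g)
  case (Suc m)
  from Suc.IH[of "\<lambda>j. g (Suc j)"] Suc.prems obtain x where
    x: "x < k ^ m" "\<And>j. j < m \<Longrightarrow> x div k ^ j mod k = g (Suc j)" by auto
  have k: "g 0 < k" using Suc.prems by simp
  have "g 0 + k * x < k + k * x" using k by simp
  also have "\<dots> = k * Suc x" by simp
  also have "\<dots> \<le> k * k ^ m" using x(1) by (intro mult_left_mono) simp_all
  finally have "g 0 + k * x < k ^ Suc m" by simp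
  moreover have "(g 0 + k * x) div k ^ j mod k = g j" if "j < Suc m" for j
  proof (cases j)
    case 0
    then show ?thesis using k by simp
  next
    case (Suc i)
    have "(g 0 + k * x) div k ^ Suc i = (g 0 + k * x) div k div k ^ i" by (simp add: div_mult2_eq)
    then show ?thesis using x(2)[of i] k Suc that by simp
  qed
  ultimately show ?case by blast
qed simp

text \<open>The definitions up to \<open>target_code\<close> use only quantifiers and cardinalities
  over explicit ranges of numbers, so that each can be transcribed into an
  \<open>hexp\<close>.\<close>

locale recoloring_input =
  fixes I :: lcsr_input
begin

definition adjacent :: "nat \<Rightarrow> nat \<Rightarrow> bool" where
  "adjacent u v \<longleftrightarrow> {u, v} \<in> edge_set I"

definition twins :: "nat \<Rightarrow> nat \<Rightarrow> bool" where
  "twins u v \<longleftrightarrow> (\<forall>w<num_vertices I. adjacent u w \<longleftrightarrow> adjacent v w) \<and>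
     (\<forall>c<num_colors I. c \<in> color_lists I u \<longleftrightarrow> c \<in> color_lists I v) \<and>
     start_coloring I u = start_coloring I v \<and> target_coloring I u = target_coloring I v"

definition first_twin :: "nat \<Rightarrow> bool" where
  "first_twin u \<longleftrightarrow> (\<forall>w<u. \<not> twins w u)"

definition num_classes :: nat where
  "num_classes = card {u. u < num_vertices I \<and> first_twin u}"

text \<open>The classes are numbered in the order of their least elements: the last conjunct says that
  \<open>u\<close> is less than the least twin of \<open>v\<close>.\<close>

definition class_index :: "nat \<Rightarrow> nat" where
  "class_index v = card {u. u < num_vertices I \<and> first_twin u \<and> (\<forall>w<Suc u. \<not> twins w v)}"

definition num_codes :: nat where
  "num_codes = num_colors I ^ num_classes"

definition code_color :: "nat \<Rightarrow> nat \<Rightarrow> nat" where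
  "code_color x v = x div num_colors I ^ class_index v mod num_colors I"

definition valid_code :: "nat \<Rightarrow> bool" where
  "valid_code x \<longleftrightarrow> (\<forall>v<num_vertices I. code_color x v \<in> color_lists I v \<and>
     (\<forall>u<num_vertices I. adjacent u v \<longrightarrow> code_color x u \<noteq> code_color x v))"

text \<open>Stated by pairs of vertices to avoid naming the class that changes. It also admits that
  nothing changes; \<open>walk_step\<close> excludes this by a nonzero cost.\<close>

definition recolors_class :: "nat \<Rightarrow> nat \<Rightarrow> bool" where
  "recolors_class x y \<longleftrightarrow> (\<forall>u<num_vertices I. \<forall>v<num_vertices I. class_index u = class_index v \<or>
     code_color x u = code_color y u \<or> code_color x v = code_color y v)"

definition recoloring_cost :: "nat \<Rightarrow> nat \<Rightarrow> nat" where
  "recoloring_cost x y = card {v. v < num_vertices I \<and> code_color x v \<noteq> code_color y v}"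

definition start_code :: "nat \<Rightarrow> bool" where
  "start_code x \<longleftrightarrow> (\<forall>v<num_vertices I. code_color x v = start_coloring I v)"

definition target_code :: "nat \<Rightarrow> bool" where
  "target_code x \<longleftrightarrow> (\<forall>v<num_vertices I. code_color x v = target_coloring I v)"

text \<open>The nonzero cost makes the weight grow strictly with each step, so every predecessor
  lies in an earlier layer of the table.\<close>

inductive walk :: "nat \<Rightarrow> nat \<Rightarrow> bool" where
  walk_start: "y < num_codes \<Longrightarrow> start_code y \<Longrightarrow> walk 0 y"
| walk_step: "walk l x \<Longrightarrow> y < num_codes \<Longrightarrow> valid_code y \<Longrightarrow> recolors_class x y \<Longrightarrow>
    recoloring_cost x y \<noteq> 0 \<Longrightarrow> walk (l + recoloring_cost x y) y"

lemma walk_less: "walk l y \<Longrightarrow> y < num_codes"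
  by (induction rule: walk.induct) auto

text \<open>The recurrence evaluated by the program. The predecessor's weight is found by truncated
  subtraction, hence the conjunct \<open>recoloring_cost x y \<le> l\<close>.\<close>

lemma walk_unfold:
  assumes "y < num_codes"
  shows "walk l y \<longleftrightarrow> l = 0 \<and> start_code y \<or> (\<exists>x<num_codes. valid_code y \<and> recolors_class x y \<and>
    recoloring_cost x y \<noteq> 0 \<and> recoloring_cost x y \<le> l \<and> walk (l - recoloring_cost x y) x)" (is "_ \<longleftrightarrow> ?R")
proof
  show "walk l y \<Longrightarrow> ?R" by (erule walk.cases) (auto dest: walk_less)
  show "?R \<Longrightarrow> walk l y"
  proof (elim disjE exE conjE)
    fix x
    assume "walk (l - recoloring_cost x y) x" "valid_code y" "recolors_class x y"
      "recoloring_cost x y \<noteq> 0" and le: "recoloring_cost x y \<le> l"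
    from walk_step[OF this(1) assms this(2-4)] le show "walk l y" by simp
  qed (use assms in \<open>auto intro: walk_start\<close>)
qed

lemma twins_refl [simp]: "twins v v"
  by (simp add: twins_def)

lemma twins_sym: "twins u v \<Longrightarrow> twins v u"
  by (simp add: twins_def)

lemma twins_trans: "twins u v \<Longrightarrow> twins v w \<Longrightarrow> twins u w"
  by (simp add: twins_def)

lemma first_twins_eq: "first_twin u \<Longrightarrow> first_twin v \<Longrightarrow> twins u v \<Longrightarrow> u = v"
  unfolding first_twin_def by (metis linorder_neqE_nat twins_sym)

definition least_twin :: "nat \<Rightarrow> nat" where
  "least_twin v = (LEAST w. twins w v)"

lemma least_twin: "twins (least_twin v) v" "first_twin (least_twin v)" "least_twin v \<le> v"
proof -
  show t: "twins (least_twin v) v" unfolding least_twin_def by (rule LeastI) (rule twins_refl)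
  show "least_twin v \<le> v" unfolding least_twin_def by (rule Least_le) simp
  show "first_twin (least_twin v)" unfolding first_twin_def
    using t twins_trans not_less_Least unfolding least_twin_def by blast
qed

lemma least_twin_eq_iff: "least_twin u = least_twin v \<longleftrightarrow> twins u v"
proof
  show "least_twin u = least_twin v \<Longrightarrow> twins u v"
    using least_twin(1)[of u] least_twin(1)[of v] twins_sym twins_trans by metis
  assume "twins u v"
  then have "twins (least_twin u) (least_twin v)"
    using least_twin(1)[of u] least_twin(1)[of v] by (blast intro: twins_sym twins_trans)
  then show "least_twin u = least_twin v" by (intro first_twins_eq least_twin(2))
qed

text \<open>The definition is shaped for evaluation by bounded loops; this form, the rank of the
  least twin, is the one used in proofs.\<close>

lemma class_index_eq: "class_index v = card {u. u < num_vertices I \<and> first_twin u \<and> u < least_twin v}"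
proof -
  have "(\<forall>w<Suc u. \<not> twins w v) \<longleftrightarrow> u < least_twin v" for u
  proof
    assume *: "\<forall>w<Suc u. \<not> twins w v"
    then have "\<not> least_twin v < Suc u" using least_twin(1)[of v] by blast
    then show "u < least_twin v" by simp
  next
    assume u: "u < least_twin v"
    show "\<forall>w<Suc u. \<not> twins w v"
    proof (intro allI impI)
      fix w assume "w < Suc u"
      with u have "w < least_twin v" by simp
      then show "\<not> twins w v" unfolding least_twin_def by (rule not_less_Least)
    qed
  qed
  then show ?thesis by (simp add: class_index_def)
qed

lemma class_index_less:
  assumes "v < num_vertices I"
  shows "class_index v < num_classes"
  unfolding class_index_eq num_classes_def
proof (rule psubset_card_mono)
  have "least_twin v \<in> {u. u < num_vertices I \<and> first_twin u}"
    using assms least_twin(2,3)[of v] by simp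
  then show "{u. u < num_vertices I \<and> first_twin u \<and> u < least_twin v}
      \<subset> {u. u < num_vertices I \<and> first_twin u}" by blast
qed simp

text \<open>\<open>least_twin u\<close> itself is counted for \<open>v\<close> but not for
  \<open>u\<close>. Strictness makes the numbering of classes injective.\<close>

lemma class_index_less_of_least_twin:
  assumes "u < num_vertices I" "least_twin u < least_twin v"
  shows "class_index u < class_index v"
  unfolding class_index_eq
proof (rule psubset_card_mono)
  have "least_twin u \<in> {w. w < num_vertices I \<and> first_twin w \<and> w < least_twin v}"
    using assms least_twin(2,3)[of u] by simp
  moreover have "{w. w < num_vertices I \<and> first_twin w \<and> w < least_twin u}
      \<subseteq> {w. w < num_vertices I \<and> first_twin w \<and> w < least_twin v}" using assms(2) by auto
  ultimately show "{w. w < num_vertices I \<and> first_twin w \<and> w < least_twin u}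
      \<subset> {w. w < num_vertices I \<and> first_twin w \<and> w < least_twin v}" by blast
qed simp

lemma class_index_eq_iff:
  assumes "u < num_vertices I" "v < num_vertices I"
  shows "class_index u = class_index v \<longleftrightarrow> twins u v"
proof
  assume "class_index u = class_index v"
  then have "\<not> least_twin u < least_twin v" "\<not> least_twin v < least_twin u"
    using class_index_less_of_least_twin assms by fastforce+
  then show "twins u v" by (simp add: least_twin_eq_iff[symmetric])
next
  assume "twins u v"
  then have "least_twin u = least_twin v" by (simp add: least_twin_eq_iff)
  then show "class_index u = class_index v" unfolding class_index_eq by simp
qed

lemma num_classes_le: "num_classes \<le> num_vertices I"
  unfolding num_classes_def
  by (rule order_trans[OF card_mono[of "{..<num_vertices I}"]]) auto

lemma recoloring_cost_le: "recoloring_cost x y \<le> num_vertices I"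
  unfolding recoloring_cost_def
  by (rule order_trans[OF card_mono[of "{..<num_vertices I}"]]) auto

end

locale recoloring_instance = recoloring_input +
  assumes inst: "I \<in> list_coloring_shortest_reconfiguration"
begin

abbreviation proper_coloring :: "(nat \<Rightarrow> nat) \<Rightarrow> bool" where
  "proper_coloring \<equiv> list_coloring (vertex_set I) (edge_set I) (color_set I) (color_lists I)"

lemma proper_start: "proper_coloring (start_coloring I)"
  and proper_target: "proper_coloring (target_coloring I)"
  and lists_subset: "v < num_vertices I \<Longrightarrow> c \<in> color_lists I v \<Longrightarrow> c < num_colors I"
  and reconfigurable: "\<exists>l. lcsr_reconfigurable_in I l"
  and colors_le: "num_colors I \<le> color_bound I"
  and cover_le: "vertex_cover_number (vertex_set I) (edge_set I) \<le> cover_bound I"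
  and graph: "simple_graph (vertex_set I) (edge_set I)"
  using inst
  by (auto simp: list_coloring_shortest_reconfiguration_def vertex_set_def color_set_def)

lemma proper_coloring_less: "proper_coloring f \<Longrightarrow> v < num_vertices I \<Longrightarrow> f v < num_colors I"
  by (auto simp: list_coloring_def vertex_set_def color_set_def dest: PiE_mem)

lemma num_colors_pos: "v < num_vertices I \<Longrightarrow> 0 < num_colors I"
  using proper_coloring_less[OF proper_start, of v] by simp

lemma num_codes_pos: "0 < num_codes"
proof (cases "num_vertices I = 0")
  \<comment> \<open>Without vertices there may be no colors, but then there are no classes either
    and the power is \<open>1\<close>.\<close>
  case True
  then show ?thesis by (simp add: num_codes_def num_classes_def)
next
  case False
  with num_colors_pos[of 0] show ?thesis by (simp add: num_codes_def)
qed

lemma exists_code: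
  assumes "\<And>u. u < num_vertices I \<Longrightarrow> G u < num_colors I"
    and "\<And>u v. u < num_vertices I \<Longrightarrow> v < num_vertices I \<Longrightarrow> twins u v \<Longrightarrow> G u = G v"
  shows "\<exists>x<num_codes. \<forall>v<num_vertices I. code_color x v = G v"
proof -
  \<comment> \<open>A digit is read off from an arbitrary vertex of its class. The default
    \<open>0\<close> spares showing that every place below \<open>num_classes\<close> is taken; it
    is a legal digit once some vertex exists.\<close>
  define g where "g j = (if \<exists>v<num_vertices I. class_index v = j
    then G (SOME v. v < num_vertices I \<and> class_index v = j) else 0)" for j
  have g: "g (class_index v) = G v" if "v < num_vertices I" for v
  proof -
    let ?w = "SOME w. w < num_vertices I \<and> class_index w = class_index v"
    have "?w < num_vertices I \<and> class_index ?w = class_index v" by (rule someI) (use that in simp)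
    then show ?thesis using assms(2)[of ?w v] that class_index_eq_iff unfolding g_def by auto
  qed
  have "g j < num_colors I" if "j < num_classes" for j
  proof (cases "\<exists>v<num_vertices I. class_index v = j")
    case True
    then show ?thesis using g assms(1) by metis
  next
    case False
    have "0 < num_vertices I" using that num_classes_le by simp
    then show ?thesis using num_colors_pos unfolding g_def if_not_P[OF False] by blast
  qed
  from exists_digits[of num_classes g, OF this] show ?thesis
    unfolding num_codes_def code_color_def using g class_index_less by metis
qed

lemma proper_valid_code:
  assumes "valid_code x"
  shows "proper_coloring (restrict (code_color x) (vertex_set I))"
  using assms lists_subset unfolding list_coloring_def valid_code_def adjacent_def vertex_set_def color_set_def
  by auto

lemma proper_start_code:
  assumes "start_code x"
  shows "restrict (code_color x) (vertex_set I) = start_coloring I"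
proof (rule PiE_ext[where k = "vertex_set I" and s = "\<lambda>_. UNIV"])
  show "start_coloring I \<in> vertex_set I \<rightarrow>\<^sub>E UNIV"
    using proper_start unfolding list_coloring_def by (auto simp: PiE_def)
qed (use assms in \<open>auto simp: start_code_def vertex_set_def\<close>)

text \<open>Equal neighborhoods would turn an edge between twins into a loop at \<open>v\<close>,
  whose edge set has only one element.\<close>

lemma twins_not_adjacent:
  assumes "twins u v" "u < num_vertices I" "v < num_vertices I"
  shows "\<not> adjacent u v"
proof
  assume "adjacent u v"
  then have "adjacent v v" using assms by (simp add: twins_def)
  then show False using graph by (force simp: adjacent_def simple_graph_def)
qed

text \<open>Soundness of walks: the vertices changed by a step lie in one class and are pairwise
  nonadjacent, so the step unfolds into as many single recolorings as its cost. Properness joins the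
  induction because both ends of a step must be proper.\<close>

lemma walk_reconfigurable:
  assumes "walk l y"
  shows "reconfigurable_in (vertex_set I) (edge_set I) (color_set I) (color_lists I)
    (start_coloring I) (restrict (code_color y) (vertex_set I)) l \<and>
    proper_coloring (restrict (code_color y) (vertex_set I))"
  using assms
proof (induction rule: walk.induct)
  case (walk_start y)
  then show ?case using proper_start by (simp add: proper_start_code reconfigurable_in_refl)
next
  case (walk_step l x y)
  let ?f = "\<lambda>x. restrict (code_color x) (vertex_set I)"
  have "{v\<in>vertex_set I. ?f x v \<noteq> ?f y v} = {v. v < num_vertices I \<and> code_color x v \<noteq> code_color y v}"
    by (auto simp: vertex_set_def)
  then have c: "recoloring_cost x y = card {v\<in>vertex_set I. ?f x v \<noteq> ?f y v}"
    by (simp add: recoloring_cost_def)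
  have indep: "{u, v} \<notin> edge_set I"
    if "u \<in> vertex_set I" "v \<in> vertex_set I" "?f x u \<noteq> ?f y u" "?f x v \<noteq> ?f y v" for u v
    using that walk_step.hyps(4) twins_not_adjacent class_index_eq_iff
    by (auto simp: recolors_class_def vertex_set_def adjacent_def)
  have fin: "finite (vertex_set I)" by (simp add: vertex_set_def)
  have proper: "proper_coloring (?f y)" using walk_step.hyps(3) by (rule proper_valid_code)
  show ?case
    using reconfigurable_in_recolor_independent[OF fin conjunct1[OF walk_step.IH]
      conjunct2[OF walk_step.IH] proper indep] proper unfolding c by blast
qed

text \<open>Within each class, all vertices can follow the one that is recolored least often.\<close>

lemma reconfigurable_walk:
  assumes "lcsr_reconfigurable_in I l"
  shows "\<exists>l'\<le>l. \<exists>y<num_codes. target_code y \<and> walk l' y"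
proof -
  let ?n = "num_vertices I"
  obtain F where F: "\<And>i. i \<le> l \<Longrightarrow> proper_coloring (F i)"
    "\<And>i. i < l \<Longrightarrow> card {v\<in>vertex_set I. F i v \<noteq> F (Suc i) v} = 1"
    "F 0 = start_coloring I" "F l = target_coloring I"
    using assms unfolding lcsr_reconfigurable_in_def reconfigurable_in_def
      reconfiguration_sequence_def adjacent_colorings_def by blast
  define changes where "changes v = (\<Sum>i<l. of_bool (F i v \<noteq> F (Suc i) v) :: nat)" for v
  define r where "r v = (ARG_MIN changes u. u < ?n \<and> twins u v)" for v
  have r: "r v < ?n" "twins (r v) v" "changes (r v) \<le> changes v" if "v < ?n" for v
  proof -
    have "r v < ?n \<and> twins (r v) v" unfolding r_def
      by (rule arg_min_natI[of "\<lambda>u. u < ?n \<and> twins u v" v]) (use that in simp)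
    then show "r v < ?n" "twins (r v) v" by simp_all
    show "changes (r v) \<le> changes v" unfolding r_def
      by (rule arg_min_nat_le[of "\<lambda>u. u < ?n \<and> twins u v" v]) (use that in simp)
  qed
  \<comment> \<open>Twins give the same minimization predicate, so \<open>ARG_MIN\<close> makes the
    same choice for the whole class and \<open>G i\<close> is class-uniform.\<close>
  have r_cong: "r u = r v" if "twins u v" for u v
  proof -
    have "(\<lambda>w. w < ?n \<and> twins w u) = (\<lambda>w. w < ?n \<and> twins w v)"
      using that by (blast intro: twins_trans twins_sym)
    then show ?thesis by (simp add: r_def)
  qed
  define G where "G i v = F i (r v)" for i v
  define cost where "cost i = card {v. v < ?n \<and> G i v \<noteq> G (Suc i) v}" for i
  have code: "\<exists>x<num_codes. \<forall>v<?n. code_color x v = G i v" if "i \<le> l" for i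
    by (rule exists_code) (use that F(1) r r_cong proper_coloring_less in \<open>auto simp: G_def\<close>)
  have valid: "valid_code x" if "i \<le> l" "\<forall>v<?n. code_color x v = G i v" for i x
    unfolding valid_code_def
  proof (intro allI impI conjI)
    fix v assume v: "v < ?n"
    have "F i (r v) \<in> color_lists I (r v)"
      using F(1)[OF that(1)] r(1)[OF v] by (auto simp: list_coloring_def vertex_set_def)
    then show "code_color x v \<in> color_lists I v"
      using r(2)[OF v] lists_subset[OF r(1)[OF v]] that v by (auto simp: G_def twins_def)
    \<comment> \<open>The edge is moved one end at a time: \<open>u\<close> to \<open>r u\<close>,
      then, read in the other direction, \<open>v\<close> to \<open>r v\<close>.\<close>
    fix u assume u: "u < ?n" and "adjacent u v"
    then have "adjacent (r u) v" using r(2)[OF u] v by (simp add: twins_def)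
    then have "adjacent v (r u)" by (simp add: adjacent_def insert_commute)
    then have "adjacent (r v) (r u)" using r(2)[OF v] r(1)[OF u] by (simp add: twins_def)
    then show "code_color x u \<noteq> code_color x v"
      using F(1)[OF that(1)] r(1)[OF u] r(1)[OF v] that(2) u v
      by (auto simp: G_def list_coloring_def vertex_set_def adjacent_def insert_commute)
  qed
  have "\<exists>x<num_codes. (\<forall>v<?n. code_color x v = G i v) \<and> walk (\<Sum>j<i. cost j) x" if "i \<le> l" for i
    using that
  proof (induction i)
    case 0
    from code[of 0] obtain x where x: "x < num_codes" "\<forall>v<?n. code_color x v = G 0 v" by auto
    moreover have "start_code x" using x r(1,2) F(3) by (auto simp: start_code_def G_def twins_def)
    ultimately show ?case by (auto intro: walk_start)
  next
    case (Suc i)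
    then obtain x where x: "x < num_codes" "\<forall>v<?n. code_color x v = G i v" "walk (\<Sum>j<i. cost j) x" by auto
    from code[OF Suc.prems] obtain y where
      y: "y < num_codes" "\<forall>v<?n. code_color y v = G (Suc i) v" by auto
    have c: "recoloring_cost x y = cost i" unfolding recoloring_cost_def cost_def
      using x(2) y(2) by (intro arg_cong[of _ _ card]) auto
    show ?case
    proof (cases "cost i = 0")
      case True
      \<comment> \<open>The vertex recolored by \<open>F\<close> represents no class, so the walk
        rests: \<open>x\<close> also encodes the next coloring.\<close>
      then have "\<forall>v<?n. G i v = G (Suc i) v" unfolding cost_def by simp
      with x True show ?thesis by auto
    next
      case False
      have "recolors_class x y" unfolding recolors_class_def
      proof (intro allI impI)
        fix u v assume uv: "u < ?n" "v < ?n"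
        \<comment> \<open>Only \<open>z\<close> changes in this step of \<open>F\<close>, so any two
          vertices changing under \<open>G\<close> have the common representative
          \<open>z\<close>.\<close>
        obtain z where z: "{v\<in>vertex_set I. F i v \<noteq> F (Suc i) v} = {z}"
          using F(2)[of i] Suc.prems by (auto simp: card_1_singleton_iff)
        show "class_index u = class_index v \<or> code_color x u = code_color y u \<or>
          code_color x v = code_color y v"
        proof (rule ccontr)
          assume neg: "\<not> ?thesis"
          then have "r u \<in> {z}" "r v \<in> {z}" unfolding z[symmetric]
            using x(2) y(2) uv r(1) by (auto simp: G_def vertex_set_def)
          then have "twins u v" using r(2) uv by (metis singletonD twins_sym twins_trans)
          with neg uv show False by (simp add: class_index_eq_iff)
        qed
      qed
      from walk_step[OF x(3) y(1) valid[OF Suc.prems y(2)] this] False c y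
      show ?thesis by (intro exI[of _ y]) simp
    qed
  qed
  from this[of l] obtain y where y: "y < num_codes" "\<forall>v<?n. code_color y v = G l v"
    "walk (\<Sum>j<l. cost j) y" by auto
  have "target_code y" using y r(1,2) F(4) by (auto simp: target_code_def G_def twins_def)
  \<comment> \<open>Double counting: summing over vertices first, minimality of each representative
    applies termwise; summing over time first, every step of \<open>F\<close> contributes exactly
    \<open>1\<close>.\<close>
  moreover have "(\<Sum>j<l. cost j) \<le> l"
  proof -
    have card: "card {v. v < ?n \<and> P v} = (\<Sum>v<?n. of_bool (P v))" for P
      by (simp add: Int_def)
    have "(\<Sum>j<l. cost j) = (\<Sum>v<?n. changes (r v))"
      unfolding cost_def card changes_def G_def by (rule sum.swap)
    also have "\<dots> \<le> (\<Sum>v<?n. changes v)" by (rule sum_mono) (simp add: r)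
    also have "\<dots> = (\<Sum>j<l. card {v. v < ?n \<and> F j v \<noteq> F (Suc j) v})"
      unfolding card changes_def by (rule sum.swap)
    also have "\<dots> = l" using F(2) by (simp add: vertex_set_def)
    finally show ?thesis .
  qed
  ultimately show ?thesis using y by blast
qed

text \<open>Instead of cutting cycles out of a walk, the proof lets the set of codes reachable
  within weight \<open>m * num_vertices I\<close> grow with \<open>m\<close>. A step costs at most
  \<open>num_vertices I\<close>, so once the set stagnates it is closed under steps, and it
  stagnates by index \<open>num_codes\<close>.\<close>

lemma walk_short:
  assumes "walk l y"
  shows "\<exists>l'\<le>num_vertices I * num_codes. walk l' y"
proof -
  define A where "A m = {y. \<exists>l'\<le>m * num_vertices I. walk l' y}" for m
  have mono: "A i \<subseteq> A j" if "i \<le> j" for i j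
    using that unfolding A_def by (auto intro: order_trans[OF _ mult_right_mono])
  have fin: "finite (A m)" and le: "card (A m) \<le> num_codes" for m
  proof -
    have *: "A m \<subseteq> {..<num_codes}" unfolding A_def by (auto dest: walk_less)
    then show "finite (A m)" by (rule finite_subset) simp
    show "card (A m) \<le> num_codes" using card_mono[OF _ *] by simp
  qed
  have "\<exists>m\<le>num_codes. A (Suc m) = A m"
  proof (rule ccontr)
    assume *: "\<not> ?thesis"
    have "m \<le> card (A m)" if "m \<le> Suc num_codes" for m
      using that
    proof (induction m)
      case (Suc m)
      then have "A m \<subset> A (Suc m)" using * mono[of m "Suc m"] by auto
      from psubset_card_mono[OF fin this] Suc show ?case by simp
    qed simp
    from this[of "Suc num_codes"] le[of "Suc num_codes"] show False by simp
  qed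
  then obtain m where m: "m \<le> num_codes" "A (Suc m) = A m" by blast
  have "y \<in> A m" using assms
  proof (induction rule: walk.induct)
    case (walk_start y)
    then show ?case by (auto simp: A_def intro: walk.walk_start)
  next
    case (walk_step l x y)
    then obtain l' where "l' \<le> m * num_vertices I" "walk l' x" by (auto simp: A_def)
    then have "l' + recoloring_cost x y \<le> Suc m * num_vertices I" "walk (l' + recoloring_cost x y) y"
      using walk_step.hyps recoloring_cost_le[of x y] by (auto intro: walk.walk_step)
    then have "y \<in> A (Suc m)" unfolding A_def by blast
    then show ?case using m by simp
  qed
  then show ?thesis using mono[OF m(1)] by (auto simp: A_def mult.commute)
qed

text \<open>A minimum written as a count, to be computed by \<open>BSum\<close>: the weights up to
  which no target code is reached are exactly those below the minimum. The range is justified by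
  \<open>walk_short\<close>.\<close>

lemma shortest_reconfiguration_length_eq:
  "shortest_reconfiguration_length I = card {l. l < Suc (num_vertices I * num_codes) \<and>
     (\<forall>l'<Suc l. \<forall>y<num_codes. \<not> (target_code y \<and> walk l' y))}"
proof -
  let ?P = "\<lambda>l. \<exists>y<num_codes. target_code y \<and> walk l y"
  let ?s = "shortest_reconfiguration_length I"
  have sound: "lcsr_reconfigurable_in I l" if "?P l" for l
  proof -
    from that obtain y where y: "target_code y" "walk l y" by blast
    have "restrict (code_color y) (vertex_set I) = target_coloring I"
    proof (rule PiE_ext[where k = "vertex_set I" and s = "\<lambda>_. UNIV"])
      show "target_coloring I \<in> vertex_set I \<rightarrow>\<^sub>E UNIV"
        using proper_target unfolding list_coloring_def by (auto simp: PiE_def)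
    qed (use y in \<open>auto simp: target_code_def vertex_set_def\<close>)
    with walk_reconfigurable[OF y(2)] show ?thesis by (simp add: lcsr_reconfigurable_in_def)
  qed
  have s: "lcsr_reconfigurable_in I ?s" unfolding shortest_reconfiguration_length_def
    using reconfigurable by (rule LeastI_ex)
  have least: "?s \<le> l" if "?P l" for l
    unfolding shortest_reconfiguration_length_def using sound[OF that] by (rule Least_le)
  \<comment> \<open>A walk no longer than the optimum exists, and by soundness none is
    shorter.\<close>
  obtain l where l: "l \<le> ?s" "?P l" using reconfigurable_walk[OF s] by blast
  with least have P: "?P ?s" by (metis order_antisym)
  then obtain y where "y < num_codes" "target_code y" "walk ?s y" by blast
  with walk_short least have "?s \<le> num_vertices I * num_codes" by (meson order_trans)
  then have "{l. l < Suc (num_vertices I * num_codes) \<and> (\<forall>l'<Suc l. \<not> ?P l')} = {..<?s}"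
    (is "?S = _") using P least by (auto simp: less_Suc_eq_le) (meson leD le_less_linear order_trans)+
  then have "card ?S = ?s" by simp
  moreover have "(\<forall>y<num_codes. \<not> (target_code y \<and> walk l y)) \<longleftrightarrow> \<not> ?P l" for l by blast
  ultimately show ?thesis by simp
qed

text \<open>The summand \<open>d\<close> pays for least twins inside the cover. Outside it, the
  factors \<open>2 ^ d\<close> count sets of neighbors and lists, and \<open>d * d\<close> the pairs
  of initial and final color.\<close>

lemma num_classes_bound:
  fixes d :: nat
  assumes "color_bound I + cover_bound I \<le> d"
  shows "num_classes \<le> d + 2 ^ d * (2 ^ d * (d * d))"
proof -
  let ?V = "vertex_set I"
  \<comment> \<open>Edges are nonempty, so the whole vertex set is a cover and the
    \<open>LEAST\<close> in \<open>vertex_cover_number\<close> is attained.\<close>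
  have "e \<inter> ?V \<noteq> {}" if "e \<in> edge_set I" for e
  proof -
    have "e \<subseteq> ?V" "card e = 2" using graph that by (simp_all add: simple_graph_def)
    then show ?thesis by (metis card.empty inf.absorb1 zero_neq_numeral)
  qed
  then have "vertex_cover ?V (edge_set I) ?V" by (simp add: vertex_cover_def)
  then have "\<exists>m S. vertex_cover ?V (edge_set I) S \<and> card S = m" by blast
  from LeastI_ex[OF this] obtain S where
    S: "vertex_cover ?V (edge_set I) S" "card S = vertex_cover_number ?V (edge_set I)"
    unfolding vertex_cover_number_def by blast
  have "S \<subseteq> ?V" using S(1) by (simp add: vertex_cover_def)
  then have finS: "finite S" by (rule finite_subset) (simp add: vertex_set_def)
  have cS: "card S \<le> d" using S(2) cover_le assms by simp
  have cC: "num_colors I \<le> d" using colors_le assms by simp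
  let ?R = "{u. u < num_vertices I \<and> first_twin u}"
  let ?type = "\<lambda>u. ({w. w < num_vertices I \<and> adjacent u w}, color_lists I u, start_coloring I u, target_coloring I u)"
  let ?T = "Pow S \<times> Pow (color_set I) \<times> color_set I \<times> color_set I"
  have finT: "finite ?T" using finS by (simp add: color_set_def)
  have "inj_on ?type (?R - S)"
  proof (rule inj_onI)
    fix u v assume uv: "u \<in> ?R - S" "v \<in> ?R - S" and eq: "?type u = ?type v"
    have "adjacent u w \<longleftrightarrow> adjacent v w" if "w < num_vertices I" for w
    proof -
      have "w \<in> {w. w < num_vertices I \<and> adjacent u w} \<longleftrightarrow> w \<in> {w. w < num_vertices I \<and> adjacent v w}"
        using eq by simp
      then show ?thesis using that by simp
    qed
    then have "twins u v" using eq by (simp add: twins_def)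
    then show "u = v" using uv by (intro first_twins_eq) simp_all
  qed
  moreover have "?type ` (?R - S) \<subseteq> ?T"
  proof (rule image_subsetI)
    fix u assume u: "u \<in> ?R - S"
    have "w \<in> S" if "adjacent u w" for w
      using that u S(1) by (auto simp: vertex_cover_def adjacent_def)
    then show "?type u \<in> ?T"
      using u lists_subset[of u] proper_coloring_less[OF proper_start, of u]
        proper_coloring_less[OF proper_target, of u] by (auto simp: color_set_def)
  qed
  ultimately have "card (?R - S) \<le> card ?T" using finT by (rule card_inj_on_le)
  also have "\<dots> = 2 ^ card S * (2 ^ num_colors I * (num_colors I * num_colors I))"
    using finS by (simp add: card_cartesian_product card_Pow color_set_def)
  also have "\<dots> \<le> 2 ^ d * (2 ^ d * (d * d))"
    using cS cC by (intro mult_mono power_increasing) simp_all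
  finally have "card (?R - S) \<le> 2 ^ d * (2 ^ d * (d * d))" .
  moreover have "num_classes \<le> card S + card (?R - S)"
  proof -
    have "?R \<subseteq> S \<union> (?R - S)" by blast
    then have "card ?R \<le> card (S \<union> (?R - S))" by (rule card_mono[rotated]) (simp add: finS)
    also have "\<dots> \<le> card S + card (?R - S)" by (rule card_Un_le)
    finally show ?thesis by (simp add: num_classes_def)
  qed
  ultimately show ?thesis using cS by simp
qed

end


section \<open>Derived operators: Boolean connectives, bounded quantifiers, remainder and local
  binding\<close>

definition hnot :: "hexp \<Rightarrow> hexp" where "hnot h = Minus (Num 1) h"
text \<open>Every nonzero value counts as true. Since \<open>Minus\<close> truncates,
  \<open>hnot\<close> yields \<open>0\<close> or \<open>1\<close>, and doubling it in
  \<open>hor\<close> and \<open>hex\<close> normalizes a sum to a truth value.\<close>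

definition hand :: "hexp \<Rightarrow> hexp \<Rightarrow> hexp" where "hand g h = hnot (Plus (hnot g) (hnot h))"
definition hor :: "hexp \<Rightarrow> hexp \<Rightarrow> hexp" where "hor g h = hnot (hnot (Plus g h))"
definition hle :: "hexp \<Rightarrow> hexp \<Rightarrow> hexp" where "hle g h = hnot (Minus g h)"
definition heq :: "hexp \<Rightarrow> hexp \<Rightarrow> hexp" where "heq g h = hand (hle g h) (hle h g)"
definition hall :: "hexp \<Rightarrow> hexp \<Rightarrow> hexp" where "hall e h = hnot (BSum e (hnot h))"
definition hex :: "hexp \<Rightarrow> hexp \<Rightarrow> hexp" where "hex e h = hnot (hnot (BSum e h))"
definition hmod :: "hexp \<Rightarrow> hexp \<Rightarrow> hexp" where "hmod g h = Minus g (Times (Quot g h) h)"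
definition hlet :: "hexp \<Rightarrow> hexp \<Rightarrow> hexp" where "hlet g h = Iter (Num 1) g h"

context
  fixes B :: nat and inp tab :: "nat \<Rightarrow> nat"
begin

abbreviation "val \<equiv> heval inp tab"
abbreviation "bdd \<equiv> bounded_by B inp tab"

lemma val_hnot [simp]: "val (hnot h) \<rho> = of_bool (val h \<rho> = 0)"
  by (simp add: hnot_def)

lemma val_hand [simp]: "val (hand g h) \<rho> = of_bool (val g \<rho> \<noteq> 0 \<and> val h \<rho> \<noteq> 0)"
  by (simp add: hand_def)

lemma val_hor [simp]: "val (hor g h) \<rho> = of_bool (val g \<rho> \<noteq> 0 \<or> val h \<rho> \<noteq> 0)"
  by (simp add: hor_def)

lemma val_hle [simp]: "val (hle g h) \<rho> = of_bool (val g \<rho> \<le> val h \<rho>)"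
  by (simp add: hle_def)

lemma val_heq [simp]: "val (heq g h) \<rho> = of_bool (val g \<rho> = val h \<rho>)"
  by (auto simp: heq_def)

lemma val_hall [simp]: "val (hall e h) \<rho> = of_bool (\<forall>i<val e \<rho>. val h (i # \<rho>) \<noteq> 0)"
  by (auto simp: hall_def)

lemma val_hex [simp]: "val (hex e h) \<rho> = of_bool (\<exists>i<val e \<rho>. val h (i # \<rho>) \<noteq> 0)"
  by (auto simp: hex_def)

lemma val_hmod [simp]: "val (hmod g h) \<rho> = val g \<rho> mod val h \<rho>"
  by (simp add: hmod_def minus_div_mult_eq_mod)

lemma val_hlet [simp]: "val (hlet g h) \<rho> = val h (val g \<rho> # \<rho>)"
  by (simp add: hlet_def)

lemma bdd_simps [simp]:
  "bdd (hnot h) \<rho> \<longleftrightarrow> bdd h \<rho>"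
  "bdd (hand g h) \<rho> \<longleftrightarrow> bdd g \<rho> \<and> bdd h \<rho>"
  "bdd (hor g h) \<rho> \<longleftrightarrow> bdd g \<rho> \<and> bdd h \<rho>"
  "bdd (hle g h) \<rho> \<longleftrightarrow> bdd g \<rho> \<and> bdd h \<rho>"
  "bdd (heq g h) \<rho> \<longleftrightarrow> bdd g \<rho> \<and> bdd h \<rho>"
  "bdd (hall e h) \<rho> \<longleftrightarrow> bdd e \<rho> \<and> val e \<rho> \<le> B \<and> (\<forall>i<val e \<rho>. bdd h (i # \<rho>))"
  "bdd (hex e h) \<rho> \<longleftrightarrow> bdd e \<rho> \<and> val e \<rho> \<le> B \<and> (\<forall>i<val e \<rho>. bdd h (i # \<rho>))"
  "bdd (hmod g h) \<rho> \<longleftrightarrow> bdd g \<rho> \<and> bdd h \<rho> \<and> 0 < val h \<rho> \<and> val g \<rho> div val h \<rho> \<le> B"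
  "bdd (hlet g h) \<rho> \<longleftrightarrow> bdd g \<rho> \<and> bdd h (val g \<rho> # \<rho>) \<and> 1 \<le> B"
  by (auto simp: hnot_def hand_def hor_def hle_def heq_def hall_def hex_def hmod_def hlet_def)

end

lemma sum_of_bool: "(\<Sum>i<n. of_bool (P i)) = card {i. i < n \<and> P i}" for n :: nat
  by (simp add: Int_def)


section \<open>The reconfiguration algorithm\<close>

definition h_vertices :: hexp where "h_vertices = Inp (Num 0)"
definition h_colors :: hexp where "h_colors = Inp (Num 1)"

text \<open>The addresses skip four header cells and the blocks preceding the one that is read. The
  first factor of a product is its loop count, so it is always a vertex or the number of
  vertices.\<close>

definition h_adjacent :: "hexp \<Rightarrow> hexp \<Rightarrow> hexp" where
  "h_adjacent u v = Inp (Plus (Num 4) (Plus (Times u h_vertices) v))"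

definition h_list :: "hexp \<Rightarrow> hexp \<Rightarrow> hexp" where
  "h_list v c = Inp (Plus (Num 4) (Plus (Times h_vertices h_vertices) (Plus (Times v h_colors) c)))"

definition h_start :: "hexp \<Rightarrow> hexp" where
  "h_start v = Inp (Plus (Num 4) (Plus (Times h_vertices h_vertices)
     (Plus (Times h_vertices h_colors) v)))"

definition h_target :: "hexp \<Rightarrow> hexp" where
  "h_target v = Inp (Plus (Num 4) (Plus (Times h_vertices h_vertices)
     (Plus (Times h_vertices h_colors) (Plus h_vertices v))))"

text \<open>From here on, arguments of type \<^typ>\<open>nat\<close> are de Bruijn indices of variables.\<close>

definition h_twins :: "nat \<Rightarrow> nat \<Rightarrow> hexp" where
  "h_twins u v = hand
     (hand (hall h_vertices (heq (h_adjacent (Var (Suc u)) (Var 0)) (h_adjacent (Var (Suc v)) (Var 0))))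
           (hall h_colors (heq (h_list (Var (Suc u)) (Var 0)) (h_list (Var (Suc v)) (Var 0)))))
     (hand (heq (h_start (Var u)) (h_start (Var v))) (heq (h_target (Var u)) (h_target (Var v))))"

definition h_first_twin :: "nat \<Rightarrow> hexp" where
  "h_first_twin u = hall (Var u) (hnot (h_twins 0 (Suc u)))"

definition h_classes :: hexp where
  "h_classes = BSum h_vertices (h_first_twin 0)"

definition h_index :: "nat \<Rightarrow> hexp" where
  "h_index v = BSum h_vertices (hand (h_first_twin 0)
     (hall (Plus (Var 0) (Num 1)) (hnot (h_twins 0 (Suc (Suc v))))))"

definition h_codes :: hexp where
  "h_codes = Iter h_classes (Num 1) (Times h_colors (Var 0))"

text \<open>Dividing repeatedly by the number of colors replaces division by a power; the quotients
  never exceed the code and so stay within the loop bound.\<close>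

definition h_color :: "nat \<Rightarrow> nat \<Rightarrow> hexp" where
  "h_color x v = hmod (Iter (h_index v) (Var x) (Quot (Var 0) h_colors)) h_colors"

definition h_valid :: "nat \<Rightarrow> hexp" where
  "h_valid x = hall h_vertices (hand (h_list (Var 0) (h_color (Suc x) 0))
     (hall h_vertices (hor (hnot (h_adjacent (Var 0) (Var (Suc 0))))
       (hnot (heq (h_color (Suc (Suc x)) 0) (h_color (Suc (Suc x)) (Suc 0)))))))"

definition h_recolors_class :: "nat \<Rightarrow> nat \<Rightarrow> hexp" where
  "h_recolors_class x y = hall h_vertices (hall h_vertices
     (hor (heq (h_index (Suc 0)) (h_index 0))
     (hor (heq (h_color (Suc (Suc x)) (Suc 0)) (h_color (Suc (Suc y)) (Suc 0)))
          (heq (h_color (Suc (Suc x)) 0) (h_color (Suc (Suc y)) 0)))))"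

definition h_cost :: "nat \<Rightarrow> nat \<Rightarrow> hexp" where
  "h_cost x y = BSum h_vertices (hnot (heq (h_color (Suc x) 0) (h_color (Suc y) 0)))"

definition h_start_code :: "nat \<Rightarrow> hexp" where
  "h_start_code x = hall h_vertices (heq (h_color (Suc x) 0) (h_start (Var 0)))"

definition h_target_code :: "nat \<Rightarrow> hexp" where
  "h_target_code x = hall h_vertices (heq (h_color (Suc x) 0) (h_target (Var 0)))"

text \<open>The table entry at \<open>l * num_codes + y\<close> tells whether there is a walk of weight \<open>l\<close> to \<open>y\<close>.\<close>

definition h_walk :: "nat \<Rightarrow> nat \<Rightarrow> hexp" where
  "h_walk l y = hor (hand (hnot (Var l)) (h_start_code y))
     (hex h_codes (hlet (h_cost 0 (Suc y))
       (hand (hand (h_valid (Suc (Suc y))) (h_recolors_class (Suc 0) (Suc (Suc y))))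
       (hand (hand (Var 0) (hle (Var 0) (Var (Suc (Suc l)))))
             (Tab (Plus (Times (Minus (Var (Suc (Suc l))) (Var 0)) h_codes) (Var (Suc 0))))))))"

definition h_entry :: hexp where
  "h_entry = hlet (Quot (Var 0) h_codes) (hlet (hmod (Var (Suc 0)) h_codes) (h_walk (Suc 0) 0))"

definition h_layers :: hexp where
  "h_layers = Plus (Times h_vertices h_codes) (Num 1)"

definition h_output :: hexp where
  "h_output = BSum h_layers (hall (Plus (Var 0) (Num 1)) (hall h_codes
     (hnot (hand (h_target_code 0) (Tab (Plus (Times (Var (Suc 0)) h_codes) (Var 0)))))))"

text \<open>The size in stack cell \<open>0\<close> and the counter in variable \<open>0\<close>
  must survive the evaluation of an entry, hence \<open>h\<close> is compiled at levels
  \<open>1\<close> and \<open>1\<close>.\<close>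

definition fill_table :: "hexp \<Rightarrow> hexp \<Rightarrow> prog" where
  "fill_table e h = Seq (compile e 0 0) (Seq (set_var 0 (Const 0))
     (Loop (Sub (temp 0) (var 0))
       (Seq (compile h 1 1) (Seq (Write 5 (var 0) (temp 1)) (set_var 0 (Add (var 0) (Const 1)))))))"

text \<open>Course-of-values recursion: an entry has to come out right for every table that is right
  below \<open>p\<close>, whatever it holds from \<open>p\<close> on.\<close>

lemma fill_table_correct:
  assumes size: "bounded_by B (s 0) (s 5) e []" "heval (s 0) (s 5) e [] = c" "c \<le> B"
    and entry: "\<And>tab p. p < c \<Longrightarrow> (\<And>q. q < p \<Longrightarrow> tab q = F q) \<Longrightarrow>
      bounded_by B (s 0) tab h [p] \<and> heval (s 0) tab h [p] = F p"
  shows "runs B (fill_table e h) s (\<lambda>s'. s' 0 = s 0 \<and> (\<forall>q<c. s' 5 q = F q))"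
proof -
  define J where "J i s' \<longleftrightarrow> s' 0 = s 0 \<and> s' 4 0 = c \<and> s' 3 0 = i \<and> (\<forall>q<i. s' 5 q = F q)"
    for i and s' :: store
  have body: "runs B (Seq (compile h 1 1) (Seq (Write 5 (var 0) (temp 1))
      (set_var 0 (Add (var 0) (Const 1))))) s' (J (Suc i))" if "i < c" "J i s'" for i s'
  proof -
    have "bounded_by B (s' 0) (s' 5) h [i]" "heval (s' 0) (s' 5) h [i] = F i"
      using entry[of i "s' 5"] that by (auto simp: J_def)
    then have "runs B (compile h 1 1) s' (leaves 1 1 (F i) s')"
      using compile_correct[of "[i]" s' B h 1] that by (simp add: J_def)
    then show ?thesis using that
      by (intro runs_Seq runs_Write, elim runs_mono)
        (auto intro!: runs_Seq runs_Write simp: J_def leaves_def less_Suc_eq)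
  qed
  show ?thesis unfolding fill_table_def
  proof (rule runs_Seq, rule runs_mono, rule compile_correct[of "[]" s B e 0, simplified], goal_cases)
    case (2 s1)
    show ?case
    proof (intro runs_Seq runs_Write, rule runs_mono[OF runs_Loop[where I = J and c = c]], goal_cases)
      case (3 i s')
      then have "eval_expr (Sub (temp 0) (var 0)) s' \<noteq> 0" by (simp add: J_def)
      with body[OF 3] show ?case by blast
    qed (use 2 size in \<open>auto simp: J_def leaves_def\<close>)
  qed (use size in simp)
qed

definition lcsr_program :: prog where
  "lcsr_program = Seq (fill_table (Times h_layers h_codes) h_entry)
     (Seq (compile h_output 0 0) (Write 2 (Const 0) (temp 0)))"

text \<open>Separates the program from the encoding: all that matters is what is read at the
  relevant addresses and that \<open>B\<close> dominates the loop ranges. The size of the table also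
  bounds the numbers of codes and of layers.\<close>

locale recoloring_word = recoloring_instance +
  fixes B :: nat and inp :: "nat \<Rightarrow> nat"
  assumes inp_vertices: "inp 0 = num_vertices I" and inp_colors: "inp 1 = num_colors I"
    and inp_adjacent: "\<lbrakk>u < num_vertices I; v < num_vertices I\<rbrakk> \<Longrightarrow>
      inp (4 + (u * num_vertices I + v)) = of_bool (adjacent u v)"
    and inp_list: "\<lbrakk>v < num_vertices I; c < num_colors I\<rbrakk> \<Longrightarrow>
      inp (4 + (num_vertices I * num_vertices I + (v * num_colors I + c))) = of_bool (c \<in> color_lists I v)"
    and inp_start: "v < num_vertices I \<Longrightarrow>
      inp (4 + (num_vertices I * num_vertices I + (num_vertices I * num_colors I + v))) = start_coloring I v"
    and inp_target: "v < num_vertices I \<Longrightarrow>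
      inp (4 + (num_vertices I * num_vertices I + (num_vertices I * num_colors I + (num_vertices I + v))))
        = target_coloring I v"
    and vertices_le: "num_vertices I \<le> B" and colors_le_B: "num_colors I \<le> B"
    and table_le: "(num_vertices I * num_codes + 1) * num_codes \<le> B"
begin

lemma codes_le: "num_codes \<le> B"
  using table_le num_codes_pos by (simp add: algebra_simps)

lemma layers_le: "num_vertices I * num_codes + 1 \<le> B"
proof -
  have "(num_vertices I * num_codes + 1) * 1 \<le> (num_vertices I * num_codes + 1) * num_codes"
    using num_codes_pos by (intro mult_left_mono) simp_all
  then show ?thesis using table_le unfolding mult_1_right by (rule order_trans)
qed

lemma B_pos: "Suc 0 \<le> B"
  using layers_le by simp

abbreviation "eval_in \<equiv> heval inp"
abbreviation "bdd_in \<equiv> bounded_by B inp"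

lemma vertices [simp]: "eval_in tab h_vertices \<rho> = num_vertices I" "bdd_in tab h_vertices \<rho>"
  by (simp_all add: h_vertices_def inp_vertices)

lemma colors [simp]: "eval_in tab h_colors \<rho> = num_colors I" "bdd_in tab h_colors \<rho>"
  by (simp_all add: h_colors_def inp_colors[simplified])

lemma eval_adjacent [simp]:
  "\<lbrakk>eval_in tab u \<rho> < num_vertices I; eval_in tab v \<rho> < num_vertices I\<rbrakk> \<Longrightarrow>
    eval_in tab (h_adjacent u v) \<rho> = of_bool (adjacent (eval_in tab u \<rho>) (eval_in tab v \<rho>))"
  by (simp add: h_adjacent_def inp_adjacent)

lemma bdd_adjacent [simp]:
  "eval_in tab u \<rho> < num_vertices I \<Longrightarrow>
    bdd_in tab (h_adjacent u v) \<rho> \<longleftrightarrow> bdd_in tab u \<rho> \<and> bdd_in tab v \<rho>"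
  using vertices_le by (auto simp: h_adjacent_def)

lemma eval_list [simp]:
  "\<lbrakk>eval_in tab v \<rho> < num_vertices I; eval_in tab c \<rho> < num_colors I\<rbrakk> \<Longrightarrow>
    eval_in tab (h_list v c) \<rho> = of_bool (eval_in tab c \<rho> \<in> color_lists I (eval_in tab v \<rho>))"
  by (simp add: h_list_def inp_list)

lemma bdd_list [simp]:
  "eval_in tab v \<rho> < num_vertices I \<Longrightarrow>
    bdd_in tab (h_list v c) \<rho> \<longleftrightarrow> bdd_in tab v \<rho> \<and> bdd_in tab c \<rho>"
  using vertices_le by (auto simp: h_list_def)

lemma eval_start [simp]:
  "eval_in tab v \<rho> < num_vertices I \<Longrightarrow> eval_in tab (h_start v) \<rho> = start_coloring I (eval_in tab v \<rho>)"
  by (simp add: h_start_def inp_start)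

lemma eval_target [simp]:
  "eval_in tab v \<rho> < num_vertices I \<Longrightarrow> eval_in tab (h_target v) \<rho> = target_coloring I (eval_in tab v \<rho>)"
  by (simp add: h_target_def inp_target)

lemma bdd_start [simp]: "bdd_in tab (h_start v) \<rho> \<longleftrightarrow> bdd_in tab v \<rho>"
  and bdd_target [simp]: "bdd_in tab (h_target v) \<rho> \<longleftrightarrow> bdd_in tab v \<rho>"
  using vertices_le by (simp_all add: h_start_def h_target_def)

lemma eval_twins [simp]:
  "\<lbrakk>\<rho> ! u < num_vertices I; \<rho> ! v < num_vertices I\<rbrakk> \<Longrightarrow>
    eval_in tab (h_twins u v) \<rho> = of_bool (twins (\<rho> ! u) (\<rho> ! v))"
  by (simp add: h_twins_def twins_def of_bool_eq_iff)

lemma bdd_twins [simp]: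
  "\<lbrakk>u < length \<rho>; v < length \<rho>; \<rho> ! u < num_vertices I; \<rho> ! v < num_vertices I\<rbrakk> \<Longrightarrow>
    bdd_in tab (h_twins u v) \<rho>"
  using vertices_le colors_le_B by (simp add: h_twins_def)

lemma eval_first_twin [simp]:
  "\<rho> ! u < num_vertices I \<Longrightarrow> eval_in tab (h_first_twin u) \<rho> = of_bool (first_twin (\<rho> ! u))"
  by (simp add: h_first_twin_def first_twin_def)

lemma bdd_first_twin [simp]:
  "\<lbrakk>u < length \<rho>; \<rho> ! u < num_vertices I\<rbrakk> \<Longrightarrow> bdd_in tab (h_first_twin u) \<rho>"
  using vertices_le by (simp add: h_first_twin_def)

lemma eval_classes [simp]: "eval_in tab h_classes \<rho> = num_classes"
  by (simp add: h_classes_def num_classes_def sum_of_bool[symmetric] cong: sum.cong_simp)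

lemma bdd_classes [simp]: "bdd_in tab h_classes \<rho>"
  using vertices_le by (simp add: h_classes_def)

lemma eval_index [simp]:
  assumes "\<rho> ! v < num_vertices I"
  shows "eval_in tab (h_index v) \<rho> = class_index (\<rho> ! v)"
  unfolding h_index_def class_index_def sum_of_bool[symmetric] heval.simps vertices
  using assms by (intro sum.cong) auto

lemma bdd_index [simp]:
  "\<lbrakk>v < length \<rho>; \<rho> ! v < num_vertices I\<rbrakk> \<Longrightarrow> bdd_in tab (h_index v) \<rho>"
  using vertices_le by (auto simp: h_index_def)

lemma eval_codes [simp]: "eval_in tab h_codes \<rho> = num_codes"
proof -
  have "((\<lambda>x. num_colors I * x) ^^ i) 1 = num_colors I ^ i" for i
    by (induction i) simp_all
  then show ?thesis by (simp add: h_codes_def num_codes_def)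
qed

lemma bdd_codes [simp]: "bdd_in tab h_codes \<rho>"
  using vertices_le colors_le_B num_classes_le by (simp add: h_codes_def)

lemma funpow_div: "((\<lambda>x. x div k) ^^ i) x = x div k ^ i" for k x :: nat
  by (induction i) (simp_all add: div_mult2_eq[symmetric] mult.commute)

lemma eval_color [simp]:
  "\<rho> ! v < num_vertices I \<Longrightarrow> eval_in tab (h_color x v) \<rho> = code_color (\<rho> ! x) (\<rho> ! v)"
  by (simp add: h_color_def code_color_def funpow_div)

lemma bdd_color [simp]:
  assumes "x < length \<rho>" "v < length \<rho>" "\<rho> ! v < num_vertices I" "\<rho> ! x < num_codes"
  shows "bdd_in tab (h_color x v) \<rho>"
proof -
  have "class_index (\<rho> ! v) \<le> B"
    using class_index_less[OF assms(3)] num_classes_le vertices_le by simp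
  moreover have "\<rho> ! x div q \<le> B" for q
    using div_le_dividend[of "\<rho> ! x" q] assms(4) codes_le by linarith
  ultimately show ?thesis using assms num_colors_pos[OF assms(3)]
    by (simp add: h_color_def funpow_div div_mult2_eq[symmetric])
qed

lemma code_color_less: "v < num_vertices I \<Longrightarrow> code_color x v < num_colors I"
  using num_colors_pos by (simp add: code_color_def)

lemma eval_valid [simp]: "eval_in tab (h_valid x) \<rho> = of_bool (valid_code (\<rho> ! x))"
  by (auto simp: h_valid_def valid_code_def code_color_less)

lemma bdd_valid [simp]: "\<lbrakk>x < length \<rho>; \<rho> ! x < num_codes\<rbrakk> \<Longrightarrow> bdd_in tab (h_valid x) \<rho>"
  using vertices_le by (simp add: h_valid_def)

lemma eval_recolors_class [simp]:
  "eval_in tab (h_recolors_class x y) \<rho> = of_bool (recolors_class (\<rho> ! x) (\<rho> ! y))"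
  by (auto simp: h_recolors_class_def recolors_class_def)

lemma bdd_recolors_class [simp]:
  "\<lbrakk>x < length \<rho>; \<rho> ! x < num_codes; y < length \<rho>; \<rho> ! y < num_codes\<rbrakk> \<Longrightarrow>
    bdd_in tab (h_recolors_class x y) \<rho>"
  using vertices_le by (simp add: h_recolors_class_def)

lemma eval_cost [simp]: "eval_in tab (h_cost x y) \<rho> = recoloring_cost (\<rho> ! x) (\<rho> ! y)"
  unfolding h_cost_def recoloring_cost_def sum_of_bool[symmetric] heval.simps vertices
  by (intro sum.cong) auto

lemma bdd_cost [simp]:
  "\<lbrakk>x < length \<rho>; \<rho> ! x < num_codes; y < length \<rho>; \<rho> ! y < num_codes\<rbrakk> \<Longrightarrow> bdd_in tab (h_cost x y) \<rho>"
  using vertices_le by (simp add: h_cost_def)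

lemma eval_start_code [simp]: "eval_in tab (h_start_code x) \<rho> = of_bool (start_code (\<rho> ! x))"
  by (auto simp: h_start_code_def start_code_def)

lemma eval_target_code [simp]: "eval_in tab (h_target_code x) \<rho> = of_bool (target_code (\<rho> ! x))"
  by (auto simp: h_target_code_def target_code_def)

lemma bdd_start_code [simp]: "\<lbrakk>x < length \<rho>; \<rho> ! x < num_codes\<rbrakk> \<Longrightarrow> bdd_in tab (h_start_code x) \<rho>"
  and bdd_target_code [simp]: "\<lbrakk>x < length \<rho>; \<rho> ! x < num_codes\<rbrakk> \<Longrightarrow> bdd_in tab (h_target_code x) \<rho>"
  using vertices_le by (simp_all add: h_start_code_def h_target_code_def)

definition table :: "nat \<Rightarrow> nat" where
  "table p = of_bool (walk (p div num_codes) (p mod num_codes))"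

lemma table_index: "y < num_codes \<Longrightarrow> table (l * num_codes + y) = of_bool (walk l y)"
  by (simp add: table_def)

text \<open>Connectives evaluate both sides, so cells not yet filled are read as well. The conjuncts
  on the cost mask them: a positive cost within \<open>l\<close> leads to an earlier layer, hence
  below \<open>p\<close>.\<close>

lemma entry_correct:
  assumes p: "p < (num_vertices I * num_codes + 1) * num_codes"
    and tab: "\<And>q. q < p \<Longrightarrow> tab q = table q"
  shows "bdd_in tab h_entry [p] \<and> eval_in tab h_entry [p] = table p"
proof
  let ?l = "p div num_codes" and ?y = "p mod num_codes"
  have y: "?y < num_codes" using num_codes_pos by simp
  have l: "?l \<le> B" using div_le_dividend[of p num_codes] p table_le by linarith
  show "bdd_in tab h_entry [p]"
    using l y num_codes_pos B_pos codes_le by (auto simp: h_entry_def h_walk_def)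
  have "tab ((?l - c) * num_codes + x) = of_bool (walk (?l - c) x)"
    if "x < num_codes" "c \<noteq> 0" "c \<le> ?l" for c x
  proof -
    have "(?l - c) * num_codes + x < Suc (?l - c) * num_codes" using that by simp
    also have "\<dots> \<le> ?l * num_codes" using that by (intro mult_right_mono) simp_all
    also have "\<dots> \<le> p" by simp
    finally show ?thesis using tab that table_index by simp
  qed
  then show "eval_in tab h_entry [p] = table p"
    unfolding table_def walk_unfold[OF y] by (auto simp: h_entry_def h_walk_def)
qed

lemma layers [simp]: "eval_in tab h_layers \<rho> = num_vertices I * num_codes + 1" "bdd_in tab h_layers \<rho>"
  using vertices_le by (simp_all add: h_layers_def)

lemma output_correct:
  assumes tab: "\<And>q. q < (num_vertices I * num_codes + 1) * num_codes \<Longrightarrow> tab q = table q"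
  shows "bdd_in tab h_output [] \<and> eval_in tab h_output [] = shortest_reconfiguration_length I"
proof
  have t: "tab (l * num_codes + y) = of_bool (walk l y)"
    if "l < num_vertices I * num_codes + 1" "y < num_codes" for l y
  proof -
    have "l * num_codes + y < Suc l * num_codes" using that by simp
    also have "\<dots> \<le> (num_vertices I * num_codes + 1) * num_codes"
      using that by (intro mult_right_mono) simp_all
    finally show ?thesis using tab that table_index by simp
  qed
  show "bdd_in tab h_output []"
    using layers_le codes_le by (auto simp: h_output_def)
  show "eval_in tab h_output [] = shortest_reconfiguration_length I"
    unfolding shortest_reconfiguration_length_eq sum_of_bool[symmetric] h_output_def
      heval.simps layers Suc_eq_plus1[symmetric]
    using t by (intro sum.cong) auto
qed

lemma lcsr_program_correct:
  assumes "s 0 = inp"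
  shows "runs B lcsr_program s (\<lambda>s'. s' 2 0 = shortest_reconfiguration_length I)"
  unfolding lcsr_program_def
proof (rule runs_Seq, rule runs_mono, rule fill_table_correct[where F = table
    and c = "(num_vertices I * num_codes + 1) * num_codes"], goal_cases)
  case (5 s1)
  then have *: "bounded_by B (s1 0) (s1 5) h_output []"
    "heval (s1 0) (s1 5) h_output [] = shortest_reconfiguration_length I"
    using output_correct[of "s1 5"] assms by simp_all
  show ?case
    by (intro runs_Seq runs_mono[OF compile_correct[of "[]" s1 B h_output 0, simplified]])
      (use * in \<open>auto intro!: runs_Write simp: leaves_def\<close>)
qed (use assms layers_le table_le entry_correct in auto)

end


section \<open>Reading an instance from its encoding\<close>

lemma row_index_less:
  fixes a b v c :: nat
  assumes "v < a" "c < b"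
  shows "v * b + c < a * b"
proof -
  have "v * b + c < Suc v * b" using assms by simp
  also have "\<dots> \<le> a * b" using assms by (intro mult_right_mono) simp_all
  finally show ?thesis .
qed

lemma length_concat_rows: "length (concat (map (\<lambda>v. map (f v) [0..<b]) [0..<a])) = a * b"
  by (induction a) simp_all

lemma nth_concat_rows:
  assumes "v < a" "c < b"
  shows "concat (map (\<lambda>v. map (f v) [0..<b]) [0..<a]) ! (v * b + c) = f v c"
  using assms(1)
proof (induction a)
  case (Suc a)
  show ?case
  proof (cases "v = a")
    case True
    then show ?thesis using assms(2) by (simp add: nth_append length_concat_rows)
  next
    case False
    then have v: "v < a" using Suc.prems by simp
    have "v * b + c < a * b" using v assms(2) by (rule row_index_less)
    then show ?thesis using Suc.IH[OF v] by (simp add: nth_append length_concat_rows)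
  qed
qed simp

lemma length_encode_lcsr:
  "length (encode_lcsr I) = 4 + (num_vertices I * num_vertices I +
     (num_vertices I * num_colors I + (num_vertices I + num_vertices I)))"
  by (simp add: encode_lcsr_def Let_def length_concat_rows)

text \<open>The separator makes every number count, even \<open>0\<close>; the input size thus
  exceeds the number of vertices.\<close>

lemma length_le_input_size: "length w \<le> input_size w"
  by (induction w) (simp_all add: input_size_def)

lemma (in recoloring_instance) recoloring_word_encode:
  assumes "num_vertices I \<le> B" "num_colors I \<le> B" "(num_vertices I * num_codes + 1) * num_codes \<le> B"
  shows "recoloring_word I B (initial_store (encode_lcsr I) 0)"
proof -
  let ?n = "num_vertices I" and ?k = "num_colors I"
  define As where "As = concat (map (\<lambda>v. map (\<lambda>w. if {v, w} \<in> edge_set I then 1 else 0 :: nat) [0..<?n]) [0..<?n])"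
  define Ls where "Ls = concat (map (\<lambda>v. map (\<lambda>c. if c \<in> color_lists I v then 1 else 0 :: nat) [0..<?k]) [0..<?n])"
  define fs where "fs = map (start_coloring I) [0..<?n]"
  define gs where "gs = map (target_coloring I) [0..<?n]"
  have len: "length As = ?n * ?n" "length Ls = ?n * ?k" "length fs = ?n"
    unfolding As_def Ls_def fs_def by (simp_all add: length_concat_rows)
  let ?w = "[?n, ?k, color_bound I, cover_bound I] @ As @ Ls @ fs @ gs"
  have w: "encode_lcsr I = ?w"
    by (simp add: encode_lcsr_def Let_def As_def Ls_def fs_def gs_def)
  have As: "As ! (u * ?n + v) = of_bool (adjacent u v)" if "u < ?n" "v < ?n" for u v
    by (simp add: As_def adjacent_def nth_concat_rows that)
  have Ls: "Ls ! (v * ?k + c) = of_bool (c \<in> color_lists I v)" if "v < ?n" "c < ?k" for v c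
    by (simp add: Ls_def nth_concat_rows that)
  show ?thesis
    unfolding w
  proof (unfold_locales, goal_cases)
    case (3 u v)
    then show ?case using row_index_less[of u ?n v ?n] As
      by (simp add: initial_store_def nth_append len numeral_eq_Suc)
  next
    case (4 v c)
    then show ?case using row_index_less[of v ?n c ?k] Ls
      by (simp add: initial_store_def nth_append len numeral_eq_Suc)
  next
    case (5 v)
    then show ?case by (simp add: initial_store_def nth_append len numeral_eq_Suc fs_def)
  next
    case (6 v)
    then show ?case by (simp add: initial_store_def nth_append len numeral_eq_Suc gs_def)
  qed (use assms in \<open>simp_all add: initial_store_def\<close>)
qed


section \<open>Fixed-parameter tractability\<close>

text \<open>Here \<open>B\<close> may depend on \<open>d\<close>, since it serves only as a witness
  of termination.\<close>

lemma computable_heval: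
  assumes "\<And>d. \<exists>B. bounded_by B (initial_store [d] 0) (initial_store [d] 5) h []"
    and "\<And>d. heval (initial_store [d] 0) (initial_store [d] 5) h [] = f d"
  shows "computable f"
  unfolding computable_def
proof (rule exI, rule allI)
  fix d
  let ?s = "initial_store [d]"
  obtain B where "bounded_by B (?s 0) (?s 5) h []" using assms(1) by blast
  then have *: "runs B (compile h 0 0) ?s (leaves 0 0 (f d) ?s)"
    using compile_correct[of "[]" ?s B h 0] assms(2)[of d] by simp
  have "runs B (Seq (compile h 0 0) (Write 2 (Const 0) (temp 0))) ?s (\<lambda>s. s 2 0 = f d)"
    by (rule runs_Seq, rule runs_mono[OF *]) (auto intro!: runs_Write simp: leaves_def)
  then show "\<exists>t. outputs_in (Seq (compile h 0 0) (Write 2 (Const 0) (temp 0))) [d] (f d) t"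
    unfolding runs_def outputs_in_def by blast
qed

section \<open>The computable dependence on the parameter\<close>

definition class_bound :: "nat \<Rightarrow> nat" where
  "class_bound d = d + 2 ^ d * (2 ^ d * (d * d))"

text \<open>The base \<open>d + 1\<close> is at least \<open>1\<close> even for
  \<open>d = 0\<close>, as monotonicity in the exponent requires.\<close>

definition code_bound :: "nat \<Rightarrow> nat" where
  "code_bound d = (d + 1) ^ class_bound d"

text \<open>One factor for the colors and two for the codes, because the table has about
  \<open>num_vertices I * num_codes * num_codes\<close> cells. All are positive, so the product
  dominates each loop range separately.\<close>

definition loop_factor :: "nat \<Rightarrow> nat" where
  "loop_factor d = (d + 1) * ((code_bound d + 1) * (code_bound d + 1))"

primrec hpower :: "hexp \<Rightarrow> nat \<Rightarrow> hexp" where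
  "hpower g 0 = Num 1"
| "hpower g (Suc h) = Times g (hpower g h)"

lemma val_hpower [simp]: "heval inp tab (hpower g h) \<rho> = heval inp tab g \<rho> ^ h"
  by (induction h) simp_all

lemma bdd_hpower:
  "bounded_by B inp tab g \<rho> \<Longrightarrow> heval inp tab g \<rho> \<le> B \<Longrightarrow> bounded_by B inp tab (hpower g h) \<rho>"
  by (induction h) simp_all

lemma funpow_times: "((*) a ^^ i) 1 = a ^ i" for a :: nat
  by (induction i) simp_all

lemma computable_loop_factor_power: "computable (\<lambda>d. c * (2 * loop_factor d) ^ h)"
proof -
  define hd where "hd = Inp (Num 0)"
  define h2 where "h2 = Iter hd (Num 1) (Times (Num 2) (Var 0))"
  define hm where "hm = Plus hd (Times h2 (Times h2 (Times hd hd)))"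
  define hN where "hN = Iter hm (Num 1) (Times (Plus hd (Num 1)) (Var 0))"
  define hq where "hq = Times (Plus hd (Num 1)) (Times (Plus hN (Num 1)) (Plus hN (Num 1)))"
  define hf where "hf = Times (Num c) (hpower (Times (Num 2) hq) h)"
  show ?thesis
  proof (rule computable_heval[of hf])
    fix d
    let ?s = "initial_store [d]"
    let ?val = "heval (?s 0) (?s 5)"
    have d: "?val hd \<rho> = d" for \<rho> by (simp add: hd_def initial_store_def)
    have 2: "?val h2 \<rho> = 2 ^ d" for \<rho>
      using funpow_times[where a = 2 and i = d] by (simp add: h2_def d)
    have m: "?val hm \<rho> = class_bound d" for \<rho> by (simp add: hm_def d 2 class_bound_def)
    have N: "?val hN \<rho> = code_bound d" for \<rho>
      using funpow_times[where a = "d + 1" and i = "class_bound d"]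
      by (simp add: hN_def d m code_bound_def del: mult_Suc)
    have q: "?val hq \<rho> = loop_factor d" for \<rho> by (simp add: hq_def d N loop_factor_def)
    show "?val hf [] = c * (2 * loop_factor d) ^ h" by (simp add: hf_def q)
    \<comment> \<open>The sum of all quantities that occur as loop counts; any common upper bound
      would do.\<close>
    define B where "B = 2 + (d + 1) + 2 ^ d + class_bound d + (code_bound d + 1) + 2 * loop_factor d + c"
    have le: "2 \<le> B" "d + 1 \<le> B" "2 ^ d \<le> B" "class_bound d \<le> B" "code_bound d + 1 \<le> B"
      "2 * loop_factor d \<le> B" "c \<le> B" by (simp_all add: B_def)
    let ?bdd = "bounded_by B (?s 0) (?s 5)"
    have bd: "?bdd hd \<rho>" for \<rho> by (simp add: hd_def)
    have b2: "?bdd h2 \<rho>" for \<rho> using le by (simp add: h2_def bd d)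
    have bm: "?bdd hm \<rho>" for \<rho> using le by (simp add: hm_def bd b2 d 2)
    have bN: "?bdd hN \<rho>" for \<rho> using le by (simp add: hN_def bd bm d m)
    have bq: "?bdd hq \<rho>" for \<rho> using le by (simp add: hq_def bd bN d N)
    have "?bdd hf []" using le by (simp add: hf_def bdd_hpower bq q)
    then show "\<exists>B. bounded_by B (?s 0) (?s 5) hf []" by blast
  qed
qed

lemma (in recoloring_instance) loop_bounds:
  fixes S d :: nat
  defines "B \<equiv> S * loop_factor d"
  assumes S: "num_vertices I < S" and d: "d = color_bound I + cover_bound I"
  shows "num_vertices I \<le> B" "num_colors I \<le> B" "(num_vertices I * num_codes + 1) * num_codes \<le> B"
proof -
  have k: "num_colors I \<le> d" using colors_le d by simp
  have "num_codes \<le> (d + 1) ^ num_classes"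
    unfolding num_codes_def using k by (intro power_mono) simp_all
  also have "\<dots> \<le> code_bound d"
    unfolding code_bound_def class_bound_def using num_classes_bound[of d] d
    by (intro power_increasing) simp_all
  finally have N: "num_codes \<le> code_bound d + 1" by simp
  have "num_vertices I * 1 \<le> S * loop_factor d"
    using S by (intro mult_mono) (simp_all add: loop_factor_def)
  then show "num_vertices I \<le> B" by (simp add: B_def)
  have "1 * (num_colors I * 1) \<le> S * ((d + 1) * ((code_bound d + 1) * (code_bound d + 1)))"
    using S k by (intro mult_mono) simp_all
  then show "num_colors I \<le> B" by (simp add: B_def loop_factor_def)
  have "num_vertices I * num_codes + 1 \<le> S * num_codes"
  proof -
    \<comment> \<open>The layer added to \<open>num_vertices I * num_codes\<close> is absorbed by
      one more block of \<open>num_codes\<close>, which is where \<open>S\<close> has to exceed the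
      number of vertices.\<close>
    have "num_vertices I * num_codes + 1 \<le> Suc (num_vertices I) * num_codes"
      using num_codes_pos by simp
    also have "\<dots> \<le> S * num_codes" using S by (intro mult_right_mono) simp_all
    finally show ?thesis .
  qed
  then have "(num_vertices I * num_codes + 1) * num_codes \<le> (S * num_codes) * num_codes"
    by (rule mult_right_mono) simp
  also have "\<dots> = S * (1 * (num_codes * num_codes))" by simp
  also have "\<dots> \<le> S * ((d + 1) * ((code_bound d + 1) * (code_bound d + 1)))"
    using N by (intro mult_mono) simp_all
  finally show "(num_vertices I * num_codes + 1) * num_codes \<le> B"
    by (simp add: B_def loop_factor_def)
qed

theorem theorem2:
  shows "fixed_parameter_tractable list_coloring_shortest_reconfiguration encode_lcsr
           (\<lambda>I. color_bound I + cover_bound I) shortest_reconfiguration_length"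
proof -
  obtain c h where time: "\<And>B. time_bound B lcsr_program \<le> c * (B + 1) ^ h"
    using time_bound_polynomial by blast
  have "\<exists>t. outputs_in lcsr_program (encode_lcsr I) (shortest_reconfiguration_length I) t \<and>
      t \<le> (c * (2 * loop_factor (color_bound I + cover_bound I)) ^ h) * input_size (encode_lcsr I) ^ h"
    if I: "I \<in> list_coloring_shortest_reconfiguration" for I
  proof -
    interpret recoloring_instance I by unfold_locales (fact I)
    define d where "d = color_bound I + cover_bound I"
    define S where "S = input_size (encode_lcsr I)"
    define B where "B = S * loop_factor d"
    have S: "num_vertices I < S"
      using length_le_input_size[of "encode_lcsr I"] by (simp add: S_def length_encode_lcsr)
    interpret recoloring_word I B "initial_store (encode_lcsr I) 0"
      unfolding B_def by (intro recoloring_word_encode loop_bounds[OF S d_def])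
    obtain t s' where t: "exec lcsr_program (initial_store (encode_lcsr I)) t s'"
      "t \<le> time_bound B lcsr_program" "s' 2 0 = shortest_reconfiguration_length I"
      using lcsr_program_correct[of "initial_store (encode_lcsr I)", OF refl] unfolding runs_def by blast
    \<comment> \<open>Doubling absorbs the \<open>+ 1\<close>, so that the power splits into a
      factor of the parameter and a power of the input size.\<close>
    have "B + 1 \<le> 2 * loop_factor d * S" using B_pos by (simp add: B_def)
    then have "c * (B + 1) ^ h \<le> c * (2 * loop_factor d * S) ^ h"
      by (intro mult_left_mono power_mono) simp_all
    also have "\<dots> = c * (2 * loop_factor d) ^ h * S ^ h" by (simp only: power_mult_distrib mult.assoc)
    finally have "t \<le> c * (2 * loop_factor d) ^ h * S ^ h" using t(2) time[of B] by linarith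
    with t show ?thesis unfolding outputs_in_def d_def S_def by blast
  qed
  with computable_loop_factor_power[of c h] show ?thesis
    unfolding fixed_parameter_tractable_def by blast
qed

end
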